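(* Let $k\in\mathbb{N}$, let $p_1,\dots,p_k\in\mathbb{R}[x]$ be non-constant polynomials and let $a_1,\dots,a_k:\mathbb{N}\to\mathbb{R}$ be jointly scattered sequences. Then for Lebesgue-almost every $x\in\mathbb{R}$, the sequence $\big(a_1(n)p_1(x),\dots,a_k(n)p_k(x)\big)_{n\in\mathbb{N}}$ is uniformly distributed in $\mathbb{T}^k$.
   Context: $\mathbb{N}=\{1,2,\dots\}$, $\mathbb{T}^k=\mathbb{R}^k/\mathbb{Z}^k$. A sequence $(x_n)_{n\in\mathbb{N}}$ in $\mathbb{R}^k$ is uniformly distributed in $\mathbb{T}^k$ (equivalently, uniformly distributed modulo 1) if for all intervals $I_1,\dots,I_k\subset[0,1]$, $\lim_{N\to\infty}\frac1N|\{n\in\{1,\dots,N\}:\{x_n\}\in I_1\times\cdots\times I_k\}|=\mu(I_1\times\cdots\times I_k)$, where $\mu$ is $k$-dimensional Lebesgue measure and $\{y\}$ is the vector of coordinatewise fractional parts of $y\in\mathbb{R}^k$. For $\delta\in(0,1]$, a sequence $a:\mathbb{N}\to\mathbb{R}$ is $\delta$-scattered if there exists $\epsilon>0$ such that for every sufficiently large $N$, $\frac1{N^2}\sum_{1\le m<n\le N}\min\big(|a(n)-a(m)|^{-\delta},1\big)\le\frac1{(\log N)^{1+\epsilon}}$ (with the term equal to $1$ when $a(n)=a(m)$). The sequence $a$ is scattered if it is $\delta$-scattered for every $\delta\in(0,1]$. Sequences $a_1,\dots,a_k:\mathbb{N}\to\mathbb{R}$ are jointly scattered if for every non-zero $v=(v_1,\dots,v_k)\in\mathbb{R}^k$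 the sequence $v_1a_1+\cdots+v_ka_k$ is scattered. *)

theory Defs
  imports "HOL-Analysis.Analysis" "HOL-Computational_Algebra.Polynomial"
begin

text \<open>
  Sequences indexed by the positive integers are functions on \<^typ>\<open>nat\<close>; only their values at
  indices \<open>n \<ge> 1\<close> are used, so the value at \<open>0\<close> is irrelevant throughout.
  The coordinates \<open>1, \<dots>, k\<close> are the elements of an arbitrary finite index type \<open>'k\<close>.
\<close>

text \<open>
  \<^const>\<open>is_interval\<close> covers open, closed and half-open intervals, as well as degenerate and
  empty ones.
\<close>

definition uniformly_distributed_mod1 :: "(nat \<Rightarrow> real ^ 'k) \<Rightarrow> bool" where
  "uniformly_distributed_mod1 x \<longleftrightarrow>
     (\<forall>I :: 'k \<Rightarrow> real set. (\<forall>i. is_interval (I i) \<and> I i \<subseteq> {0..1}) \<longrightarrow>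
        (\<lambda>N. real (card {n \<in> {1..N}. (\<chi> i. frac (x n $ i)) \<in> {y. \<forall>i. y $ i \<in> I i}}) / real N)
          \<longlonglongrightarrow> measure lebesgue {y :: real ^ 'k. \<forall>i. y $ i \<in> I i})"

text \<open>
  The case \<open>a n = a m\<close> is split off because \<open>0 powr (- \<delta>) = 0\<close> in HOL, whereas the summand has
  to be \<open>1\<close> there.
\<close>

definition delta_scattered :: "real \<Rightarrow> (nat \<Rightarrow> real) \<Rightarrow> bool" where
  "delta_scattered \<delta> a \<longleftrightarrow>
     (\<exists>\<epsilon>>0. \<forall>\<^sub>F N in sequentially.
        1 / (real N)\<^sup>2 *
          (\<Sum>(m, n) \<in> {(m, n). 1 \<le> m \<and> m < n \<and> n \<le> N}.
             if a n = a m then 1 else min (\<bar>a n - a m\<bar> powr (- \<delta>)) 1)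
        \<le> 1 / (ln (real N)) powr (1 + \<epsilon>))"

definition scattered :: "(nat \<Rightarrow> real) \<Rightarrow> bool" where
  "scattered a \<longleftrightarrow> (\<forall>\<delta>\<in>{0<..1}. delta_scattered \<delta> a)"

definition jointly_scattered :: "('k::finite \<Rightarrow> nat \<Rightarrow> real) \<Rightarrow> bool" where
  "jointly_scattered a \<longleftrightarrow>
     (\<forall>v :: real ^ 'k. v \<noteq> 0 \<longrightarrow> scattered (\<lambda>n. \<Sum>i\<in>UNIV. v $ i * a i n))"

end

theory Submission
  imports Defs "HOL-Real_Asymp.Real_Asymp"
begin

text \<open>
  By Weyl's criterion it suffices to show, for each non-zero \<open>h \<in> \<int>\<^sup>k\<close>, that for almost every \<open>x\<close>
  the averages of \<open>e(\<Sum>\<^sub>i h\<^sub>i a\<^sub>i(n) p\<^sub>i(x))\<close> tend to \<open>0\<close>. Let \<open>d\<close> be the largest degree of a \<open>p\<^sub>i\<close> with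
  \<open>h\<^sub>i \<noteq> 0\<close>. The coefficient of \<open>x\<^sup>d\<close> in \<open>\<Sum>\<^sub>i h\<^sub>i (a\<^sub>i(n) - a\<^sub>i(m)) p\<^sub>i(x)\<close> is \<open>b(n) - b(m)\<close> for a
  non-trivial linear combination \<open>b\<close> of the \<open>a\<^sub>i\<close>, and no higher power of \<open>x\<close> occurs, so van der
  Corput's lemma bounds the integral of the corresponding exponential over a bounded interval by
  a constant times \<open>min(\<bar>b(n) - b(m)\<bar>\<^sup>-\<^sup>1\<^sup>/\<^sup>d, 1)\<close>. Since \<open>b\<close> is scattered, the mean square of the
  \<open>N\<close>-th average is \<open>O((log N)\<^sup>-\<^sup>1\<^sup>-\<^sup>\<epsilon>)\<close>. This is summable along \<open>N\<^sub>j = \<lfloor>exp(j\<^sup>\<theta>)\<rfloor>\<close> for \<open>\<theta> < 1\<close> with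
  \<open>\<theta>(1 + \<epsilon>) > 1\<close>, which gives almost everywhere convergence along this subsequence; as
  \<open>N\<^sub>j\<^sub>+\<^sub>1 / N\<^sub>j \<rightarrow> 1\<close>, the full sequence of averages converges too.
\<close>

section \<open>Van der Corput's lemma for polynomial phases\<close>

text \<open>Integration by parts, writing \<open>cis (poly P x)\<close> as its derivative divided by
  \<open>\<i> * P'\<close>. The two boundary terms contribute at most \<open>2 / l\<close>. The
  remaining integrand has modulus \<open>\<bar>P''\<bar> / P'^2\<close>, and since
  \<open>P''\<close> keeps its sign this integrates exactly to a difference of values of
  \<open>1 / P'\<close>, which is at most \<open>1 / l\<close>.\<close>

lemma norm_integral_cis_poly_first_derivative:
  fixes P :: "real poly"
  assumes ab: "a \<le> b" and l: "l > 0"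
    and low: "\<And>x. x \<in> {a..b} \<Longrightarrow> l \<le> poly (pderiv P) x"
    and sgn: "(\<forall>x\<in>{a..b}. 0 \<le> poly (pderiv (pderiv P)) x) \<or>
              (\<forall>x\<in>{a..b}. poly (pderiv (pderiv P)) x \<le> 0)"
  shows "norm (integral {a..b} (\<lambda>x. cis (poly P x))) \<le> 3 / l"
proof -
  define P1 P2 where "P1 = poly (pderiv P)" and "P2 = poly (pderiv (pderiv P))"
  have P1: "P1 x > 0" "P1 x \<noteq> 0" "l \<le> P1 x" if "x \<in> {a..b}" for x
    using low[OF that] l by (auto simp: P1_def)
  have dP: "(poly P has_field_derivative P1 x) (at x within S)" for x S
    unfolding P1_def by (rule has_field_derivative_at_within) (rule poly_DERIV)
  have dP1: "(P1 has_field_derivative P2 x) (at x within S)" for x S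
    unfolding P1_def P2_def by (rule has_field_derivative_at_within) (rule poly_DERIV)
  have contP: "continuous_on S (poly P)" "continuous_on S P1" "continuous_on S P2" for S
    unfolding P1_def P2_def by (intro continuous_intros)+
  \<comment> \<open>\<open>s\<close> is the sign of \<open>P2\<close> on the interval, so that
    \<open>\<bar>P2 x\<bar> = s * P2 x\<close> and both sign cases are treated at once.\<close>
  obtain s :: real where s: "\<bar>s\<bar> = 1" "\<And>x. x \<in> {a..b} \<Longrightarrow> s * P2 x \<ge> 0"
  proof -
    from sgn show ?thesis
    proof
      assume "\<forall>x\<in>{a..b}. 0 \<le> poly (pderiv (pderiv P)) x"
      then show ?thesis by (intro that[of 1]) (auto simp: P2_def)
    next
      assume "\<forall>x\<in>{a..b}. poly (pderiv (pderiv P)) x \<le> 0"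
      then show ?thesis by (intro that[of "-1"]) (auto simp: P2_def)
    qed
  qed
  \<comment> \<open>\<open>F\<close> is the boundary term of the integration by parts: its
    derivative is the integrand plus the error \<open>H\<close>.\<close>
  define F where "F x = - \<i> * cis (poly P x) / of_real (P1 x)" for x
  define H where "H x = \<i> * cis (poly P x) * of_real (P2 x) / of_real (P1 x)^2" for x
  have "(F has_vector_derivative (cis (poly P x) + H x)) (at x within {a..b})" if x: "x \<in> {a..b}" for x
  proof -
    have c: "((\<lambda>x. cis (poly P x)) has_vector_derivative (P1 x *\<^sub>R (\<i> * cis (poly P x)))) (at x within {a..b})"
    proof -
      have "(cis has_vector_derivative (\<i> * cis (poly P x))) (at (poly P x) within poly P ` {a..b})"
        unfolding cis_conv_exp 
        by (rule has_vector_derivative_real_field[THEN has_vector_derivative_eq_rhs])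
           (auto intro!: derivative_eq_intros)
      from vector_diff_chain_within[OF _ this, of "P1 x"] dP[of x "{a..b}"]
      show ?thesis by (simp add: has_real_derivative_iff_has_vector_derivative o_def)
    qed
    have i: "((\<lambda>x. inverse (P1 x)) has_vector_derivative (- P2 x / P1 x ^ 2)) (at x within {a..b})"
      unfolding has_real_derivative_iff_has_vector_derivative[symmetric]
      by (rule derivative_eq_intros dP1 refl)+ (use P1[OF x] in \<open>auto simp: field_simps power2_eq_square\<close>)
    have "((\<lambda>x. (-\<i>) * (inverse (P1 x) *\<^sub>R cis (poly P x))) has_vector_derivative
         (-\<i>) * (inverse (P1 x) *\<^sub>R (P1 x *\<^sub>R (\<i> * cis (poly P x))) +
            (- P2 x / P1 x ^ 2) *\<^sub>R cis (poly P x))) (at x within {a..b})"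
      by (intro has_vector_derivative_mult_right has_vector_derivative_scaleR[OF _ c])
         (use i in \<open>simp add: has_real_derivative_iff_has_vector_derivative\<close>)
    also have "(\<lambda>x. (-\<i>) * (inverse (P1 x) *\<^sub>R cis (poly P x))) = F"
      by (auto simp: F_def fun_eq_iff scaleR_conv_of_real field_simps)
    finally show ?thesis
      by (rule has_vector_derivative_eq_rhs)
         (use P1[OF x] in \<open>simp add: H_def scaleR_conv_of_real field_simps power2_eq_square\<close>)
  qed
  then have "((\<lambda>x. cis (poly P x) + H x) has_integral (F b - F a)) {a..b}"
    by (intro fundamental_theorem_of_calculus ab) auto
  moreover have intH: "H integrable_on {a..b}"
    unfolding H_def by (intro integrable_continuous_interval continuous_intros contP) (use P1 in auto)
  ultimately have "((\<lambda>x. cis (poly P x) + H x - H x) has_integral (F b - F a - integral {a..b} H)) {a..b}"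
    by (intro has_integral_diff) (auto simp: integrable_integral)
  then have eq: "integral {a..b} (\<lambda>x. cis (poly P x)) = F b - F a - integral {a..b} H"
    by (simp add: integral_unique)
  \<comment> \<open>\<open>G\<close> is an antiderivative of \<open>norm (H x)\<close>.\<close>
  define G where "G x = - s / P1 x" for x
  have "(G has_vector_derivative (s * P2 x / P1 x ^ 2)) (at x within {a..b})" if x: "x \<in> {a..b}" for x
    unfolding G_def has_real_derivative_iff_has_vector_derivative[symmetric]
    by (rule derivative_eq_intros dP1 refl)+ (use P1[OF x] in \<open>auto simp: field_simps power2_eq_square\<close>)
  then have G: "((\<lambda>x. s * P2 x / P1 x ^ 2) has_integral (G b - G a)) {a..b}"
    by (intro fundamental_theorem_of_calculus ab) auto
  have "norm (integral {a..b} H) \<le> integral {a..b} (\<lambda>x. s * P2 x / P1 x ^ 2)"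
  proof (rule integral_norm_bound_integral[OF intH])
    show "(\<lambda>x. s * P2 x / (P1 x)\<^sup>2) integrable_on {a..b}" using G by blast
    fix x assume x: "x \<in> {a..b}"
    have "\<bar>P2 x\<bar> = \<bar>s * P2 x\<bar>" using s(1) by (simp add: abs_mult)
    then have "\<bar>P2 x\<bar> = s * P2 x" using s(2)[OF x] by simp
    then show "norm (H x) \<le> s * P2 x / P1 x ^ 2"
      by (simp add: H_def norm_mult norm_divide norm_power)
  qed
  also have "\<dots> = G b - G a" using G by (rule integral_unique)
  also have "\<dots> \<le> 1 / l"
  proof -
    have "0 < 1 / P1 a" "1 / P1 a \<le> 1 / l" "0 < 1 / P1 b" "1 / P1 b \<le> 1 / l"
      using P1[of a] P1[of b] ab l by (auto intro!: frac_le)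
    then have "1 / P1 a - 1 / P1 b \<le> 1 / l" "1 / P1 b - 1 / P1 a \<le> 1 / l" by linarith+
    moreover have "s = 1 \<or> s = -1" using s(1) by auto
    moreover have "G b - G a = s * (1 / P1 a - 1 / P1 b)" by (simp add: G_def algebra_simps)
    ultimately show ?thesis by auto
  qed
  finally have "norm (integral {a..b} H) \<le> 1 / l" .
  moreover have "norm (F x) \<le> 1 / l" if "x \<in> {a..b}" for x
    using P1[OF that] l by (auto simp: F_def norm_mult norm_divide intro!: frac_le)
  from this[of a] this[of b] have "norm (F a) \<le> 1/l" "norm (F b) \<le> 1/l" using ab by auto
  ultimately have "norm (F b) + norm (F a) + norm (integral {a..b} H) \<le> 3 / l"
    using l by (simp add: field_simps)
  moreover have "norm (F b - F a - integral {a..b} H) \<le> norm (F b) + norm (F a) + norm (integral {a..b} H)"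
    by (meson norm_triangle_ineq4 add_right_mono order_trans)
  ultimately show ?thesis unfolding eq by linarith
qed

text \<open>Negating the phase conjugates the integral. Upper bounds on derivatives thereby reduce
  to lower bounds.\<close>

lemma norm_integral_cis_poly_minus:
  "norm (integral {a..b} (\<lambda>x. cis (poly (- P) x))) = norm (integral {a..b} (\<lambda>x. cis (poly P x)))"
proof -
  have "integral {a..b} (\<lambda>x. cis (poly (- P) x)) = integral {a..b} (\<lambda>x. cnj (cis (poly P x)))"
    by (simp add: cis_cnj)
  then show ?thesis by (metis integral_cnj complex_mod_cnj)
qed

lemma norm_integral_cis_le: "norm (integral {a..b} (\<lambda>x. cis (poly P x))) \<le> b - a" if "a \<le> b"
proof -
  have "norm (integral {a..b} (\<lambda>x. cis (poly P x))) \<le> 1 * (b - a)"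
    by (rule integral_bound) (use that in \<open>auto intro!: continuous_intros\<close>)
  then show ?thesis by simp
qed

lemma higher_pderiv_minus: "(pderiv ^^ n) (- p) = - (pderiv ^^ n) (p :: real poly)"
  using higher_pderiv_smult[of n "-1" p] by simp

text \<open>Induction on the order of the derivative. If the next derivative is at least
  \<open>l\<close>, the current one grows at rate \<open>l\<close> and so is at least
  \<open>l * e\<close> in modulus at distance \<open>e\<close> from a suitable point
  \<open>c\<close>. The induction hypothesis applies on both sides of a window around
  \<open>c\<close>, and the window itself is estimated by its length. The sign condition of the
  induction hypothesis is supplied by the lower bound \<open>l\<close>.\<close>

lemma van_der_Corput_poly:
  fixes P :: "real poly"
  assumes "a \<le> b" "l > 0"
    and "(\<forall>x\<in>{a..b}. l \<le> poly ((pderiv ^^ Suc k) P) x) \<or>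
         (\<forall>x\<in>{a..b}. poly ((pderiv ^^ Suc k) P) x \<le> - l)"
    and "(\<forall>x\<in>{a..b}. 0 \<le> poly ((pderiv ^^ Suc (Suc k)) P) x) \<or>
         (\<forall>x\<in>{a..b}. poly ((pderiv ^^ Suc (Suc k)) P) x \<le> 0)"
  shows "norm (integral {a..b} (\<lambda>x. cis (poly P x))) \<le> 4 ^ Suc k * l powr - (1 / real (Suc k))"
  using assms
proof (induction k arbitrary: P a b l)
  case (0 P a b l)
  have *: "norm (integral {a..b} (\<lambda>x. cis (poly Q x))) \<le> 4 / l"
    if "\<forall>x\<in>{a..b}. l \<le> poly (pderiv Q) x"
      "(\<forall>x\<in>{a..b}. 0 \<le> poly (pderiv (pderiv Q)) x) \<or>
       (\<forall>x\<in>{a..b}. poly (pderiv (pderiv Q)) x \<le> 0)" for Q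
  proof -
    have "norm (integral {a..b} (\<lambda>x. cis (poly Q x))) \<le> 3 / l"
      by (rule norm_integral_cis_poly_first_derivative) (use 0 that in auto)
    also have "\<dots> \<le> 4 / l" using 0 by (auto simp: divide_right_mono)
    finally show ?thesis .
  qed
  from "0.prems"(3) have "norm (integral {a..b} (\<lambda>x. cis (poly P x))) \<le> 4 / l"
  proof
    assume "\<forall>x\<in>{a..b}. l \<le> poly ((pderiv ^^ Suc 0) P) x"
    then show ?thesis using * 0 by auto
  next
    assume "\<forall>x\<in>{a..b}. poly ((pderiv ^^ Suc 0) P) x \<le> - l"
    then have "norm (integral {a..b} (\<lambda>x. cis (poly (-P) x))) \<le> 4 / l"
      using * [of "-P"] "0.prems"(4) by (force simp: pderiv_minus)
    then show ?thesis using norm_integral_cis_poly_minus by metis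
  qed
  then show ?case using \<open>l > 0\<close> by (simp add: powr_minus_divide)
next
  case (Suc k P a b l)
  have *: "norm (integral {a..b} (\<lambda>x. cis (poly Q x))) \<le> 4 ^ Suc (Suc k) * l powr - (1 / real (Suc (Suc k)))"
    if Q: "\<forall>x\<in>{a..b}. l \<le> poly ((pderiv ^^ Suc (Suc k)) Q) x" for Q
  proof -
    define g g' where "g = poly ((pderiv ^^ Suc k) Q)" and "g' = poly ((pderiv ^^ Suc (Suc k)) Q)"
    have g': "(g has_real_derivative g' x) (at x)" for x
      unfolding g_def g'_def by (simp add: poly_DERIV)
    have l: "l > 0" and ab: "a \<le> b" using Suc by auto
    have slope: "g y - g x \<ge> l * (y - x)" if "a \<le> x" "x \<le> y" "y \<le> b" for x y
    proof (cases "x = y")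
      case False
      then have "x < y" using that by auto
      from MVT2[OF this, of g g'] g' obtain z where "x < z" "z < y" "g y - g x = (y - x) * g' z" by auto
      moreover have "g' z \<ge> l" using Q calculation that by (auto simp: g'_def)
      ultimately show ?thesis using that by (simp add: mult.commute mult_right_mono)
    qed simp
    \<comment> \<open>\<open>c\<close> is a zero of \<open>g\<close> if \<open>g\<close> changes
      sign, and otherwise the endpoint at which the increasing function \<open>g\<close> is closest
      to zero.\<close>
    obtain c where c: "a \<le> c" "c \<le> b" "\<And>x. c < x \<Longrightarrow> x \<le> b \<Longrightarrow> l * (x - c) \<le> g x"
        "\<And>x. a \<le> x \<Longrightarrow> x < c \<Longrightarrow> g x \<le> - (l * (c - x))"
    proof -
      consider "g b \<le> 0" | "g a \<ge> 0" | "g a < 0" "g b > 0" by linarith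
      then show ?thesis
      proof cases
        case 1
        then show ?thesis using slope[of _ b] ab by (intro that[of b]) fastforce+
      next
        case 2
        show ?thesis
        proof (rule that[of a])
          show "l * (x - a) \<le> g x" if "a < x" "x \<le> b" for x
            using slope[of a x] 2 that by auto
        qed (use ab in auto)
      next
        case 3
        have "\<exists>c\<ge>a. c \<le> b \<and> g c = 0"
          by (rule IVT') (use 3 ab in \<open>auto simp: g_def intro!: continuous_intros\<close>)
        then obtain c where "a \<le> c" "c \<le> b" "g c = 0" by auto
        then show ?thesis using slope[of c] slope[of _ c] by (intro that[of c]) fastforce+
      qed
    qed
    \<comment> \<open>This width balances the two estimates: by \<open>le\<close>, the induction
      hypothesis with bound \<open>l * e\<close> gives a multiple of \<open>e\<close>, the same
      order as the length of the window.\<close>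
    define e where "e = l powr - (1 / real (Suc (Suc k)))"
    have e: "e > 0" using l by (simp add: e_def)
    have le: "(l * e) powr - (1 / real (Suc k)) = e"
    proof -
      have "l * e = l powr (1 - 1 / real (Suc (Suc k)))"
        using l by (simp add: e_def powr_diff powr_minus_divide)
      then have "(l * e) powr - (1 / real (Suc k)) = 
          l powr (- ((1 - 1 / real (Suc (Suc k))) / real (Suc k)))"
        by (simp add: powr_powr)
      also have "1 - 1 / real (Suc (Suc k)) = real (Suc k) / real (Suc (Suc k))"
        by (simp add: field_simps)
      also have "\<dots> / real (Suc k) = 1 / real (Suc (Suc k))"
        by simp
      finally show ?thesis by (simp add: e_def)
    qed
    \<comment> \<open>The window around \<open>c\<close> is clipped to \<open>{a..b}\<close>; where
      clipping occurs, the outer interval on that side is a single point and its integral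
      vanishes.\<close>
    define u v where "u = max a (c - e)" and "v = min b (c + e)"
    have uv: "a \<le> u" "u \<le> v" "v \<le> b" "v - u \<le> 2 * e" 
      using c(1,2) e by (auto simp: u_def v_def)
    define C where "C = 4 ^ Suc k * e"
    have C: "C \<ge> 4 * e" unfolding C_def using e by (intro mult_right_mono) auto
    have pos: "\<forall>x\<in>{a..b}. 0 \<le> g' x" 
      using Q l unfolding g'_def by (meson less_imp_le order_trans)
    have left: "norm (integral {a..u} (\<lambda>x. cis (poly Q x))) \<le> C"
    proof (cases "u = a")
      case False
      then have u: "u = c - e" "a < u" by (auto simp: u_def)
      have "g x \<le> - (l * e)" if "x \<in> {a..u}" for x
      proof -
        have "l * e \<le> l * (c - x)" using that u l by (intro mult_left_mono) auto
        then show ?thesis using c(4)[of x] that u e by auto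
      qed
      then have "norm (integral {a..u} (\<lambda>x. cis (poly Q x))) \<le> 4 ^ Suc k * (l * e) powr - (1 / real (Suc k))"
        using pos uv l e by (intro Suc.IH) (auto simp: g_def g'_def)
      then show ?thesis unfolding le C_def .
    qed (use C e in auto)
    have right: "norm (integral {v..b} (\<lambda>x. cis (poly Q x))) \<le> C"
    proof (cases "v = b")
      case False
      then have v: "v = c + e" "v < b" by (auto simp: v_def min_def split: if_splits)
      have "g x \<ge> l * e" if "x \<in> {v..b}" for x
      proof -
        have "l * e \<le> l * (x - c)" using that v l by (intro mult_left_mono) auto
        then show ?thesis using c(3)[of x] that v e by auto
      qed
      then have "norm (integral {v..b} (\<lambda>x. cis (poly Q x))) \<le> 4 ^ Suc k * (l * e) powr - (1 / real (Suc k))"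
        using pos uv l e by (intro Suc.IH) (auto simp: g_def g'_def)
      then show ?thesis unfolding le C_def .
    qed (use C e in auto)
    have int: "(\<lambda>x. cis (poly Q x)) integrable_on {r..s}" for r s
      by (intro integrable_continuous_interval continuous_intros)
    have "integral {a..b} (\<lambda>x. cis (poly Q x)) = integral {a..u} (\<lambda>x. cis (poly Q x)) +
        integral {u..v} (\<lambda>x. cis (poly Q x)) + integral {v..b} (\<lambda>x. cis (poly Q x))"
      using uv by (simp add: Henstock_Kurzweil_Integration.integral_combine[OF _ _ int])
    also have "norm \<dots> \<le> C + 2 * e + C"
      by (intro norm_triangle_le add_mono left right order_trans[OF norm_integral_cis_le] uv)
    \<comment> \<open>Since \<open>C \<ge> 4 * e\<close>, the three pieces together cost one further
      factor 4 per derivative.\<close>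
    also have "\<dots> \<le> 4 * C" using C e by simp
    also have "4 * C = 4 ^ Suc (Suc k) * e" by (simp add: C_def)
    finally show ?thesis unfolding e_def .
  qed
  from Suc.prems(3) show ?case
  proof
    assume "\<forall>x\<in>{a..b}. l \<le> poly ((pderiv ^^ Suc (Suc k)) P) x"
    then show ?thesis by (rule *)
  next
    assume "\<forall>x\<in>{a..b}. poly ((pderiv ^^ Suc (Suc k)) P) x \<le> - l"
    then have "\<forall>x\<in>{a..b}. l \<le> poly ((pderiv ^^ Suc (Suc k)) (- P)) x"
      unfolding higher_pderiv_minus by force
    from *[OF this] show ?thesis unfolding norm_integral_cis_poly_minus .
  qed
qed

text \<open>The \<open>d\<close>-th derivative is the constant \<open>fact d * coeff P d\<close> and
  the next one is zero, so the previous lemma applies with \<open>l = \<bar>coeff P d\<bar>\<close>,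
  using \<open>fact d \<ge> 1\<close>.\<close>

corollary norm_integral_cis_poly_leading_coeff:
  fixes P :: "real poly"
  assumes "a \<le> b" "d > 0" "degree P \<le> d" "coeff P d \<noteq> 0"
  shows "norm (integral {a..b} (\<lambda>x. cis (poly P x))) \<le> 4 ^ d * \<bar>coeff P d\<bar> powr - (1 / real d)"
proof -
  obtain k where k: "d = Suc k" using assms(2) gr0_implies_Suc by blast
  have c: "coeff ((pderiv ^^ d) P) 0 = fact d * coeff P d"
    by (simp add: coeff_higher_pderiv pochhammer_fact)
  have "degree ((pderiv ^^ d) P) = 0" using assms by (simp add: degree_higher_pderiv)
  then obtain c' where "(pderiv ^^ d) P = [:c':]" by (auto elim: degree_eq_zeroE)
  with c have d: "(pderiv ^^ d) P = [:fact d * coeff P d:]" by simp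
  then have d': "(pderiv ^^ Suc d) P = 0" by (simp add: pderiv_pCons)
  have "1 * \<bar>coeff P d\<bar> \<le> fact d * \<bar>coeff P d\<bar>" by (intro mult_right_mono) (auto simp: fact_ge_1)
  then have "\<bar>coeff P d\<bar> \<le> fact d * coeff P d \<or> fact d * coeff P d \<le> - \<bar>coeff P d\<bar>"
    by (auto simp: abs_if split: if_splits)
  then show ?thesis
    unfolding k using assms d d' by (intro van_der_Corput_poly) (auto simp: k simp del: funpow.simps)
qed

section \<open>Weyl's criterion\<close>

inductive trig_polynomial :: "(real \<Rightarrow> complex) \<Rightarrow> bool" where
  character: "trig_polynomial (\<lambda>t. c * cis (2 * pi * of_int j * t))"
| add: "trig_polynomial f \<Longrightarrow> trig_polynomial g \<Longrightarrow> trig_polynomial (\<lambda>t. f t + g t)"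

lemma trig_polynomial_const: "trig_polynomial (\<lambda>t. c)"
  using trig_polynomial.character[of c 0] by simp

lemma trig_polynomial_mult:
  assumes "trig_polynomial f" "trig_polynomial g"
  shows "trig_polynomial (\<lambda>t. f t * g t)"
  using assms
proof (induction f rule: trig_polynomial.induct)
  case (character c j)
  from character show ?case
  proof (induction g rule: trig_polynomial.induct)
    case (character d k)
    show ?case
      using trig_polynomial.character[of "c * d" "j + k"]
      by (simp add: algebra_simps flip: cis_mult)
  next
    case (add f g)
    then show ?case by (auto simp: distrib_left intro: trig_polynomial.add)
  qed
next
  case (add f1 f2)
  then show ?case by (auto simp: distrib_right intro: trig_polynomial.add)
qed

text \<open>The inductive form suits closure arguments; averages and integrals are computed termwise
  from this explicit form with distinct frequencies.\<close>

lemma trig_polynomial_expansion: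
  assumes "trig_polynomial T"
  obtains S :: "int set" and c where "finite S" "\<And>t. T t = (\<Sum>j\<in>S. c j * cis (2 * pi * of_int j * t))"
proof -
  from assms have "\<exists>S c. finite S \<and> (\<forall>t. T t = (\<Sum>j\<in>S. c j * cis (2 * pi * of_int j * t)))"
  proof induction
    case (character c j)
    show ?case by (intro exI[of _ "{j}"] exI[of _ "\<lambda>_. c"]) auto
  next
    case (add f g)
    from add.IH(1) obtain S c where S: "finite S" "\<And>t. f t = (\<Sum>j\<in>S. c j * cis (2 * pi * of_int j * t))"
      by blast
    from add.IH(2) obtain S' c' where S': "finite S'" "\<And>t. g t = (\<Sum>j\<in>S'. c' j * cis (2 * pi * of_int j * t))"
      by blast
    define d where "d j = (if j \<in> S then c j else 0) + (if j \<in> S' then c' j else 0)" for j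
    have "f t + g t = (\<Sum>j\<in>S \<union> S'. d j * cis (2 * pi * of_int j * t))" for t
    proof -
      have "f t = (\<Sum>j\<in>S \<union> S'. (if j \<in> S then c j else 0) * cis (2 * pi * of_int j * t))"
        unfolding S(2) using S S' by (intro sum.mono_neutral_cong_left) auto
      moreover have "g t = (\<Sum>j\<in>S \<union> S'. (if j \<in> S' then c' j else 0) * cis (2 * pi * of_int j * t))"
        unfolding S'(2) using S S' by (intro sum.mono_neutral_cong_left) auto
      ultimately show ?thesis by (simp add: d_def distrib_right sum.distrib)
    qed
    with S S' show ?case by (intro exI[of _ "S \<union> S'"] exI[of _ d]) auto
  qed
  then show ?thesis using that by blast
qed

lemma cis_frac: "cis (2 * pi * of_int j * frac t) = cis (2 * pi * of_int j * t)"
proof -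
  have "2 * pi * of_int j * t = 2 * pi * of_int j * frac t + 2 * pi * of_int (j * \<lfloor>t\<rfloor>)"
    by (simp add: frac_def algebra_simps)
  moreover have "cis (2 * pi * of_int (j * \<lfloor>t\<rfloor>)) = 1"
    by (rule cis_multiple_2pi) auto
  ultimately show ?thesis by (simp flip: cis_mult)
qed

lemma trig_polynomial_frac: "trig_polynomial T \<Longrightarrow> T (frac t) = T t"
  by (induction rule: trig_polynomial.induct) (simp_all add: cis_frac)

lemma trig_polynomial_continuous: "trig_polynomial T \<Longrightarrow> continuous_on S T"
  by (induction rule: trig_polynomial.induct) (auto intro!: continuous_intros)

lemma integral_cis_period:
  "integral {0..1} (\<lambda>t. cis (2 * pi * of_int j * t)) = (if j = 0 then 1 else 0)"
proof (cases "j = 0")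
  case False
  define w :: complex where "w = \<i> * of_real (2 * pi * of_int j)"
  have w: "w \<noteq> 0" using False by (simp add: w_def)
  have e: "cis (2 * pi * of_int j * t) = exp (w * of_real t)" for t
    by (simp add: cis_conv_exp w_def algebra_simps)
  have "((\<lambda>t. exp (w * of_real t)) has_integral (exp (w * of_real 1) / w - exp (w * of_real 0) / w)) {0..1}"
    by (intro fundamental_theorem_of_calculus)
       (auto intro!: derivative_eq_intros has_vector_derivative_real_field simp: w)
  moreover have "exp (w * of_real 1) = 1"
    unfolding e[symmetric] by (simp add: cis_multiple_2pi)
  ultimately show ?thesis using False by (simp add: e integral_unique)
qed simp

text \<open>Turns Stone-Weierstrass on the unit circle into trigonometric approximation. A real
  linear functional on the circle is a combination of cosine and sine, hence of the frequencies 1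
  and -1; constants, sums and products are covered by the closure properties.\<close>

lemma real_polynomial_function_trig:
  fixes g :: "complex \<Rightarrow> real"
  assumes "real_polynomial_function g"
  shows "trig_polynomial (\<lambda>t. of_real (g (cis (2 * pi * t))))"
  using assms
proof induction
  case (linear f)
  interpret bounded_linear f by fact
  have "f (cis s) = cos s * f 1 + sin s * f \<i>" for s
  proof -
    have "cis s = cos s *\<^sub>R 1 + sin s *\<^sub>R \<i>" by (simp add: complex_eq_iff)
    then show ?thesis by (simp only: add scaleR real_scaleR_def)
  qed
  moreover have "complex_of_real (cos s) = (cis s + cis (- s)) / 2"
      "complex_of_real (sin s) = (cis s - cis (- s)) / (2 * \<i>)" for s
    by (auto simp: complex_eq_iff field_simps Re_divide Im_divide power2_eq_square)
  ultimately have "complex_of_real (f (cis s)) = (cis s + cis (- s)) / 2 * of_real (f 1) +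
      (cis s - cis (- s)) / (2 * \<i>) * of_real (f \<i>)" for s
    by (simp only: of_real_add of_real_mult)
  then have *: "complex_of_real (f (cis s)) =
     (of_real (f 1) / 2 + of_real (f \<i>) / (2 * \<i>)) * cis s +
     (of_real (f 1) / 2 - of_real (f \<i>) / (2 * \<i>)) * cis (- s)" for s
    by (simp add: add_divide_distrib diff_divide_distrib algebra_simps)
  have "of_real (f (cis (2 * pi * t))) =
     (of_real (f 1) / 2 + of_real (f \<i>) / (2 * \<i>)) * cis (2 * pi * of_int 1 * t) +
     (of_real (f 1) / 2 - of_real (f \<i>) / (2 * \<i>)) * cis (2 * pi * of_int (- 1) * t)" for t
    using *[of "2 * pi * t"] by simp
  then show ?case by (simp only:) (intro trig_polynomial.intros)
qed (auto intro: trig_polynomial.intros trig_polynomial_const trig_polynomial_mult)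

text \<open>As \<open>f 0 = f 1\<close>, the function descends to a continuous function on the unit
  circle, where Stone-Weierstrass applies. The approximant keeps the bound 1 because products of
  such functions are compared factor by factor later.\<close>

lemma continuous_periodic_trig_approx:
  fixes f :: "real \<Rightarrow> real"
  assumes "continuous_on {0..1} f" "f 0 = f 1" "\<And>t. t \<in> {0..1} \<Longrightarrow> \<bar>f t\<bar> \<le> 1" "e > 0"
  obtains T where "trig_polynomial T" "\<And>t. norm (T t) \<le> 1"
    "\<And>t. t \<in> {0..1} \<Longrightarrow> norm (T t - of_real (f t)) \<le> e"
proof -
  define F where "F = f \<circ> (\<lambda>z. Arg2pi z / (2 * pi))"
  have F_cis: "F (cis (2 * pi * t)) = f (frac t)" for t
  proof -
    have "Arg2pi (cis (2 * pi * t)) = 2 * pi * frac t"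
    proof (rule Arg2pi_unique[of 1])
      show "of_real 1 * exp (\<i> * of_real (2 * pi * frac t)) = cis (2 * pi * t)"
        using cis_frac[of 1 t] by (simp add: cis_conv_exp)
      show "2 * pi * frac t < 2 * pi" using frac_lt_1[of t] by simp
    qed auto
    then show ?thesis by (simp add: F_def)
  qed
  \<comment> \<open>Continuity on the circle comes from the constant homotopy of the loop
    \<open>f\<close>, which induces a homotopy of circle maps; the jump of \<open>Arg2pi\<close>
    need not be treated by hand.\<close>
  have "homotopic_loops UNIV f f"
    using assms by (simp add: homotopic_loops_refl path_def pathfinish_def pathstart_def)
  then have "continuous_on (sphere 0 1) F"
    unfolding F_def by (blast dest: homotopic_loops_imp_homotopic_circlemaps homotopic_with_imp_continuous)
  then obtain g where g: "real_polynomial_function g" "\<And>z. z \<in> sphere 0 1 \<Longrightarrow> \<bar>F z - g z\<bar> < e / 2"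
    using Stone_Weierstrass_real_polynomial_function[of "sphere 0 1" F "e / 2"] assms(4) by auto
  define G where "G t = g (cis (2 * pi * t))" for t
  have G: "\<bar>f (frac t) - G t\<bar> < e / 2" for t
    using g(2)[of "cis (2 * pi * t)"] by (simp add: G_def F_cis)
  \<comment> \<open>\<open>G\<close> may exceed 1 in modulus by up to \<open>e / 2\<close>. Scaling
    by \<open>q\<close> restores the bound 1 and moves \<open>G\<close> by at most another
    \<open>e / 2\<close>.\<close>
  define q where "q = 1 / (1 + e / 2)"
  have q: "0 < q" "q * (1 + e / 2) = 1" "q < 1" using assms(4) by (auto simp: q_def)
  define T where "T t = of_real q * complex_of_real (G t)" for t
  have nT: "norm (T t) \<le> 1" for t
  proof -
    have "\<bar>f (frac t)\<bar> \<le> 1" by (rule assms) (auto simp: frac_lt_1 less_imp_le)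
    then have "\<bar>G t\<bar> \<le> 1 + e / 2" using G[of t] by linarith
    then have "q * \<bar>G t\<bar> \<le> q * (1 + e / 2)" using q by (intro mult_left_mono) auto
    then show ?thesis using q by (simp add: T_def norm_mult)
  qed
  have f_frac: "f (frac t) = f t" if "t \<in> {0..1}" for t
    using that assms(2) by (cases "t = 1") (auto simp: frac_eq)
  show ?thesis
  proof (rule that[of T])
    show "trig_polynomial T"
      unfolding T_def G_def by (intro trig_polynomial_mult trig_polynomial_const real_polynomial_function_trig g)
    show "norm (T t) \<le> 1" for t by fact
    fix t :: real assume t: "t \<in> {0..1}"
    have "\<bar>G t - f t\<bar> \<le> e / 2" using G[of t] unfolding f_frac[OF t] by linarith
    moreover have "\<bar>q * G t - G t\<bar> \<le> e / 2"
    proof -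
      have "\<bar>G t\<bar> \<le> 1 + e / 2" using \<open>\<bar>G t - f t\<bar> \<le> e / 2\<close> assms(3)[OF t] by linarith
      then have "(1 - q) * \<bar>G t\<bar> \<le> (1 - q) * (1 + e / 2)" using q by (intro mult_left_mono) auto
      also have "\<dots> = e / 2" unfolding left_diff_distrib q(2) by simp
      finally have "\<bar>(1 - q) * G t\<bar> \<le> e / 2" using q(3) by (simp add: abs_mult)
      then show ?thesis by (simp add: algebra_simps abs_minus_commute)
    qed
    ultimately have "\<bar>q * G t - f t\<bar> \<le> e" by linarith
    then show "norm (T t - of_real (f t)) \<le> e"
      unfolding T_def by (metis norm_of_real of_real_diff of_real_mult)
  qed
qed

section \<open>From exponential averages to averages of continuous periodic functions\<close>

lemma tendsto_of_approximation:
  fixes s :: "nat \<Rightarrow> 'a::real_normed_vector"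
  assumes "\<And>e. e > 0 \<Longrightarrow> \<exists>u l. u \<longlonglongrightarrow> l \<and> (\<forall>n. norm (s n - u n) \<le> e) \<and> norm (l - L) \<le> e"
  shows "s \<longlonglongrightarrow> L"
proof (rule tendstoI)
  fix e :: real assume "e > 0"
  then obtain u l where u: "u \<longlonglongrightarrow> l" "\<And>n. norm (s n - u n) \<le> e / 3" "norm (l - L) \<le> e / 3"
    using assms[of "e / 3"] by auto
  have "\<forall>\<^sub>F n in sequentially. dist (u n) l < e / 3"
    using u(1) \<open>e > 0\<close> by (intro tendstoD) auto
  then show "\<forall>\<^sub>F n in sequentially. dist (s n) L < e"
  proof eventually_elim
    case (elim n)
    have "s n - L = (s n - u n) + (u n - l) + (l - L)" by simp
    then have "norm (s n - L) \<le> norm (s n - u n) + norm (u n - l) + norm (l - L)"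
      by (metis norm_triangle_le add_right_mono norm_triangle_ineq order_refl)
    then show ?case using u(2)[of n] u(3) elim by (simp add: dist_norm)
  qed
qed

text \<open>Multiplying out the product yields a finite combination of exponential averages indexed
  by frequency vectors \<open>h\<close>. All of them tend to 0 except that of \<open>h = 0\<close>,
  whose coefficient is the product of the integrals of the factors.\<close>

lemma trig_polynomial_average_tendsto:
  fixes x :: "nat \<Rightarrow> real ^ 'k::finite" and T :: "'k \<Rightarrow> real \<Rightarrow> complex"
  assumes weyl: "\<And>h :: 'k \<Rightarrow> int. h \<noteq> (\<lambda>_. 0) \<Longrightarrow>
      (\<lambda>N. (\<Sum>n=1..N. cis (2 * pi * (\<Sum>i\<in>UNIV. of_int (h i) * x n $ i))) / of_nat N) \<longlonglongrightarrow> 0"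
    and T: "\<And>i. trig_polynomial (T i)"
  shows "(\<lambda>N. (\<Sum>n=1..N. \<Prod>i\<in>UNIV. T i (x n $ i)) / of_nat N)
           \<longlonglongrightarrow> (\<Prod>i\<in>UNIV. integral {0..1} (T i))"
proof -
  have "\<forall>i. \<exists>S c. finite S \<and> (\<forall>t. T i t = (\<Sum>j\<in>S. c j * cis (2 * pi * of_int j * t)))"
    using trig_polynomial_expansion[OF T] by metis
  then obtain S c where S: "\<And>i. finite (S i)"
    and Tc: "\<And>i t. T i t = (\<Sum>j\<in>S i. c i j * cis (2 * pi * of_int j * t))"
    by metis
  define \<chi>' where "\<chi>' h n = cis (2 * pi * (\<Sum>i\<in>UNIV. of_int (h i) * x n $ i))" for h :: "'k \<Rightarrow> int" and n
  define C where "C h = (\<Prod>i\<in>UNIV. c i (h i))" for h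
  have prod_cis: "(\<Prod>i\<in>A. cis (y i)) = cis (\<Sum>i\<in>A. y i)" for A :: "'k set" and y
    by (induction A rule: infinite_finite_induct) (auto simp: cis_mult)
  have expand: "(\<Prod>i\<in>UNIV. T i (x n $ i)) = (\<Sum>h\<in>PiE UNIV S. C h * \<chi>' h n)" for n
    unfolding Tc using S
    by (subst prod_sum_PiE) (auto simp: C_def \<chi>'_def prod.distrib prod_cis sum_distrib_left mult.assoc)
  have int: "integral {0..1} (T i) = (\<Sum>j\<in>S i. c i j * (if j = 0 then 1 else 0))" for i
  proof -
    have "integral {0..1} (T i) = (\<Sum>j\<in>S i. integral {0..1} (\<lambda>t. c i j * cis (2 * pi * of_int j * t)))"
      unfolding Tc using S
      by (intro integral_sum integrable_continuous_interval continuous_intros) auto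
    then show ?thesis by (simp add: integral_cis_period)
  qed
  have "(\<Prod>i\<in>UNIV. integral {0..1} (T i)) = (\<Sum>h\<in>PiE UNIV S. \<Prod>i\<in>UNIV. c i (h i) * (if h i = 0 then 1 else 0))"
    unfolding int using S by (subst prod_sum_PiE) auto
  also have "\<dots> = (\<Sum>h\<in>PiE UNIV S. C h * (if h = (\<lambda>_. 0) then 1 else 0))"
    by (intro sum.cong) (auto simp: C_def fun_eq_iff)
  finally have limit: "(\<Prod>i\<in>UNIV. integral {0..1} (T i)) =
      (\<Sum>h\<in>PiE UNIV S. C h * (if h = (\<lambda>_. 0) then 1 else 0))" .
  have "(\<lambda>N. (\<Sum>n=1..N. \<chi>' h n) / of_nat N) \<longlonglongrightarrow> (if h = (\<lambda>_. 0) then 1 else 0)" for h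
  proof (cases "h = (\<lambda>_. 0)")
    case True
    \<comment> \<open>The averages equal 1 only for \<open>N > 0\<close>, since division by zero
      yields 0.\<close>
    have "(\<lambda>N. (\<Sum>n=1..N. \<chi>' h n) / of_nat N) \<longlonglongrightarrow> 1"
      by (rule tendsto_eventually, rule eventually_mono[OF eventually_gt_at_top[of 0]])
         (simp add: \<chi>'_def True)
    with True show ?thesis by simp
  qed (use weyl in \<open>auto simp: \<chi>'_def\<close>)
  then have "(\<lambda>N. \<Sum>h\<in>PiE UNIV S. C h * ((\<Sum>n=1..N. \<chi>' h n) / of_nat N)) \<longlonglongrightarrow>
      (\<Sum>h\<in>PiE UNIV S. C h * (if h = (\<lambda>_. 0) then 1 else 0))"
    by (intro tendsto_sum tendsto_mult_left)
  also have "(\<lambda>N. \<Sum>h\<in>PiE UNIV S. C h * ((\<Sum>n=1..N. \<chi>' h n) / of_nat N)) =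
      (\<lambda>N. (\<Sum>n=1..N. \<Prod>i\<in>UNIV. T i (x n $ i)) / of_nat N)"
    unfolding expand by (subst sum.swap) (simp add: sum_distrib_left sum_divide_distrib)
  finally show ?thesis unfolding limit .
qed


text \<open>Each factor is replaced by a trigonometric polynomial. As all factors are bounded by 1,
  two products differ by at most the sum of the differences of their factors, which controls the
  averages and the limits alike.\<close>

lemma continuous_periodic_average_tendsto:
  fixes x :: "nat \<Rightarrow> real ^ 'k::finite" and f :: "'k \<Rightarrow> real \<Rightarrow> real"
  assumes weyl: "\<And>h :: 'k \<Rightarrow> int. h \<noteq> (\<lambda>_. 0) \<Longrightarrow>
      (\<lambda>N. (\<Sum>n=1..N. cis (2 * pi * (\<Sum>i\<in>UNIV. of_int (h i) * x n $ i))) / of_nat N) \<longlonglongrightarrow> 0"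
    and f: "\<And>i. continuous_on {0..1} (f i)" "\<And>i. f i 0 = f i 1"
      "\<And>i t. t \<in> {0..1} \<Longrightarrow> \<bar>f i t\<bar> \<le> 1"
  shows "(\<lambda>N. (\<Sum>n=1..N. \<Prod>i\<in>UNIV. f i (frac (x n $ i))) / real N)
           \<longlonglongrightarrow> (\<Prod>i\<in>UNIV. integral {0..1} (f i))"
proof -
  define s where "s N = complex_of_real ((\<Sum>n=1..N. \<Prod>i\<in>UNIV. f i (frac (x n $ i))) / real N)" for N
  define L where "L = complex_of_real (\<Prod>i\<in>UNIV. integral {0..1} (f i))"
  have "s \<longlonglongrightarrow> L"
  proof (rule tendsto_of_approximation)
    fix e :: real assume e: "e > 0"
    \<comment> \<open>The error allowed per factor, so that the whole product is off by at most
      \<open>e\<close>.\<close>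
    define d where "d = e / CARD('k)"
    have d: "d > 0" "CARD('k) * d = e" using e by (auto simp: d_def)
    have "\<exists>T. trig_polynomial T \<and> (\<forall>t. norm (T t) \<le> 1) \<and>
        (\<forall>t\<in>{0..1}. norm (T t - of_real (f i t)) \<le> d)" for i
      using continuous_periodic_trig_approx[of "f i" d] f d by metis
    then obtain T where T: "\<And>i. trig_polynomial (T i)" "\<And>i t. norm (T i t) \<le> 1"
        "\<And>i t. t \<in> {0..1} \<Longrightarrow> norm (T i t - of_real (f i t)) \<le> d"
      by metis
    define u where "u N = (\<Sum>n=1..N. \<Prod>i\<in>UNIV. T i (x n $ i)) / of_nat N" for N :: nat
    define l where "l = (\<Prod>i\<in>UNIV. integral {0..1} (T i))"
    have prod_le: "norm ((\<Prod>i\<in>UNIV. z i) - (\<Prod>i\<in>UNIV. w i)) \<le> e"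
      if "\<And>i. norm (z i) \<le> 1" "\<And>i. norm (w i) \<le> 1" "\<And>i. norm (z i - w i) \<le> d" for z w :: "'k \<Rightarrow> complex"
    proof -
      have "norm ((\<Prod>i\<in>UNIV. z i) - (\<Prod>i\<in>UNIV. w i)) \<le> (\<Sum>i\<in>UNIV. norm (z i - w i))"
        by (rule norm_prod_diff) (use that in auto)
      also have "\<dots> \<le> (\<Sum>i\<in>(UNIV :: 'k set). d)" by (intro sum_mono that)
      finally show ?thesis using d by simp
    qed
    have "u \<longlonglongrightarrow> l"
      unfolding u_def l_def by (rule trig_polynomial_average_tendsto[OF weyl T(1)])
    moreover have "norm (s N - u N) \<le> e" for N
    proof (cases "N = 0")
      case False
      have fr: "frac t \<in> {0..1}" for t :: real by (auto simp: frac_lt_1 less_imp_le)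
      have "norm (\<Sum>n=1..N. of_real (\<Prod>i\<in>UNIV. f i (frac (x n $ i))) - (\<Prod>i\<in>UNIV. T i (x n $ i))) \<le> (\<Sum>n=1..N. e)"
      proof (intro sum_norm_le)
        fix n
        have "norm (complex_of_real (f i (frac (x n $ i))) - T i (x n $ i)) \<le> d" for i
          using T(3)[OF fr, of i "x n $ i"] trig_polynomial_frac[OF T(1)] by (metis norm_minus_commute)
        then show "norm (of_real (\<Prod>i\<in>UNIV. f i (frac (x n $ i))) - (\<Prod>i\<in>UNIV. T i (x n $ i))) \<le> e"
          unfolding of_real_prod by (intro prod_le) (use f(3)[OF fr] T(2) in auto)
      qed
      moreover have "s N - u N =
          (\<Sum>n=1..N. of_real (\<Prod>i\<in>UNIV. f i (frac (x n $ i))) - (\<Prod>i\<in>UNIV. T i (x n $ i))) / of_nat N"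
        by (simp add: s_def u_def sum_subtractf diff_divide_distrib)
      ultimately show ?thesis using False by (simp add: norm_divide pos_divide_le_eq mult.commute)
    qed (use e in \<open>simp add: s_def u_def\<close>)
    moreover have "norm (l - L) \<le> e"
    proof -
      have bound: "norm (integral {0..1} g) \<le> c"
        if "continuous_on {0..1} g" "\<And>t. t \<in> {0..1} \<Longrightarrow> norm (g t) \<le> c" for g :: "real \<Rightarrow> complex" and c
        using integral_bound[of 0 1 g c] that by simp
      have contT: "continuous_on {0..1} (T i)" for i using T(1) by (rule trig_polynomial_continuous)
      have contf: "continuous_on {0..1} (\<lambda>t. complex_of_real (f i t))" for i
        using f(1) by (intro continuous_intros)
      have "complex_of_real (integral {0..1} (f i)) = integral {0..1} (\<lambda>t. complex_of_real (f i t))" for i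
        using integral_linear[OF integrable_continuous_interval[OF f(1)] bounded_linear_of_real[where 'a = complex], of i]
        by (simp add: o_def)
      then have L: "L = (\<Prod>i\<in>UNIV. integral {0..1} (\<lambda>t. complex_of_real (f i t)))"
        by (simp add: L_def)
      show ?thesis unfolding l_def L
      proof (intro prod_le)
        fix i
        show "norm (integral {0..1} (T i)) \<le> 1"
          by (intro bound contT T)
        show "norm (integral {0..1} (\<lambda>t. complex_of_real (f i t))) \<le> 1"
          by (intro bound contf) (use f in auto)
        have "integral {0..1} (T i) - integral {0..1} (\<lambda>t. complex_of_real (f i t)) =
            integral {0..1} (\<lambda>t. T i t - complex_of_real (f i t))"
          by (intro Henstock_Kurzweil_Integration.integral_diff[symmetric] integrable_continuous_interval contT contf)
        also have "norm \<dots> \<le> d"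
          by (intro bound continuous_intros contT contf T)
        finally show "norm (integral {0..1} (T i) - integral {0..1} (\<lambda>t. complex_of_real (f i t))) \<le> d" .
      qed
    qed
    ultimately show "\<exists>u l. u \<longlonglongrightarrow> l \<and> (\<forall>n. norm (s n - u n) \<le> e) \<and> norm (l - L) \<le> e"
      by blast
  qed
  then show ?thesis unfolding s_def L_def by (rule tendsto_of_real_iff[THEN iffD1])
qed

section \<open>From continuous periodic functions to boxes\<close>

text \<open>A continuous bump supported in \<open>{a..b}\<close> with ramps of width
  \<open>e\<close>. If \<open>b - a < 2 * e\<close> it is a tent below height 1, and if
  \<open>a = b\<close> it is zero, so short and degenerate intervals fit the same formula.\<close>

definition trapezoid :: "real \<Rightarrow> real \<Rightarrow> real \<Rightarrow> real \<Rightarrow> real" where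
  "trapezoid e a b t = max 0 (min 1 (min (t - a) (b - t) / e))"

lemma trapezoid:
  assumes "e > 0"
  shows "continuous_on S (trapezoid e a b)"
    "0 \<le> trapezoid e a b t" "trapezoid e a b t \<le> 1"
    "t \<notin> {a<..<b} \<Longrightarrow> trapezoid e a b t = 0"
    "t \<in> {a + e..b - e} \<Longrightarrow> trapezoid e a b t = 1"
proof -
  show "continuous_on S (trapezoid e a b)"
    unfolding trapezoid_def using assms by (intro continuous_intros) auto
  show "t \<notin> {a<..<b} \<Longrightarrow> trapezoid e a b t = 0"
  proof -
    assume "t \<notin> {a<..<b}"
    then have "min (t - a) (b - t) / e \<le> 0" using assms by (intro divide_nonpos_pos) auto
    then show ?thesis by (simp add: trapezoid_def)
  qed
  show "t \<in> {a + e..b - e} \<Longrightarrow> trapezoid e a b t = 1"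
    using assms by (auto simp: trapezoid_def max_def min_def field_simps)
qed (auto simp: trapezoid_def)

lemma integral_trapezoid:
  assumes "e > 0" "0 \<le> a" "a \<le> b" "b \<le> 1"
  shows "integral {0..1} (trapezoid e a b) \<in> {b - a - 2 * e..b - a}"
proof -
  note t = trapezoid[OF assms(1), where a = a and b = b]
  have int: "trapezoid e a b integrable_on {c..d}" for c d
    by (intro integrable_continuous_interval t)
  have "b - a - 2 * e \<le> integral {0..1} (trapezoid e a b)"
  proof (cases "a + e \<le> b - e")
    case True
    have "integral {a + e..b - e} (\<lambda>_. 1) \<le> integral {a + e..b - e} (trapezoid e a b)"
      by (intro integral_le int) (auto simp: t)
    also have "\<dots> \<le> integral {0..1} (trapezoid e a b)"
      by (intro integral_subset_le int) (use assms t in auto)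
    finally show ?thesis using True by simp
  next
    \<comment> \<open>Here the plateau is empty and the claimed lower bound is negative.\<close>
    case False
    moreover have "0 \<le> integral {0..1} (trapezoid e a b)"
      by (intro Henstock_Kurzweil_Integration.integral_nonneg int t)
    ultimately show ?thesis by linarith
  qed
  moreover have "integral {0..1} (trapezoid e a b) \<le> b - a"
  proof -
    have supp: "x \<in> {a..b}" if "trapezoid e a b x \<noteq> 0" for x
      using t(4)[of x] that by fastforce
    have "integral {0..1} (trapezoid e a b) = integral {a..b} (trapezoid e a b)"
      by (rule integral_spike_set[OF negligible_subset[of "{}"] negligible_subset[of "{}"]])
         (use assms supp in auto)
    also have "\<dots> \<le> integral {a..b} (\<lambda>_. 1)"
      by (intro integral_le int) (auto simp: t)
    finally show ?thesis using assms by simp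
  qed
  ultimately show ?thesis by simp
qed


text \<open>The product of indicators is squeezed between products of continuous periodic functions
  whose integrals are close to the side lengths. Only the inclusions between open and closed
  intervals enter, so any choice of endpoints is covered.\<close>

lemma box_average_tendsto:
  fixes x :: "nat \<Rightarrow> real ^ 'k::finite" and J :: "'k \<Rightarrow> real set" and a b :: "'k \<Rightarrow> real"
  assumes weyl: "\<And>h :: 'k \<Rightarrow> int. h \<noteq> (\<lambda>_. 0) \<Longrightarrow>
      (\<lambda>N. (\<Sum>n=1..N. cis (2 * pi * (\<Sum>i\<in>UNIV. of_int (h i) * x n $ i))) / of_nat N) \<longlonglongrightarrow> 0"
    and J: "\<And>i. 0 \<le> a i" "\<And>i. a i \<le> b i" "\<And>i. b i \<le> 1"
      "\<And>i. {a i<..<b i} \<subseteq> J i" "\<And>i. J i \<subseteq> {a i..b i}"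
  shows "(\<lambda>N. (\<Sum>n=1..N. \<Prod>i\<in>UNIV. indicator (J i) (frac (x n $ i))) / real N)
           \<longlonglongrightarrow> (\<Prod>i\<in>UNIV. b i - a i)"
    (is "?s \<longlonglongrightarrow> ?L")
proof (rule LIMSEQ_I)
  fix r :: real assume r: "r > 0"
  \<comment> \<open>A majorant \<open>g i\<close> involves two trapezoids, each with integral off by
    at most \<open>2 * e\<close>. With \<open>4 * e\<close> per factor the product is off by at most
    \<open>r / 2\<close>, leaving \<open>r / 2\<close> for the convergence of the averages.\<close>
  define e where "e = r / (8 * CARD('k))"
  have e: "e > 0" "8 * CARD('k) * e = r" using r by (auto simp: e_def)
  \<comment> \<open>The trapezoids vanish at \<open>0\<close> and \<open>1\<close>, so \<open>f\<close> and \<open>g\<close> are periodic minorants and majorants of the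
    indicator functions.\<close>
  define f g where "f i = trapezoid e (a i) (b i)"
    and "g i t = 1 - trapezoid e 0 (a i) t - trapezoid e (b i) 1 t" for i t
  note tr = trapezoid[OF e(1)]
  have ab: "a i \<le> 1" "0 \<le> b i" for i using J[of i] by auto
  have f: "continuous_on {0..1} (f i)" "f i 0 = f i 1" "f i t \<in> {0..1}" for i t
    using tr(1-3) tr(4)[of 0 "a i" "b i"] tr(4)[of 1 "a i" "b i"] J[of i] by (auto simp: f_def)
  \<comment> \<open>The two trapezoids subtracted in \<open>g i\<close> have disjoint supports
    because \<open>a i \<le> b i\<close>.\<close>
  have g01: "g i t \<in> {0..1}" for i t
  proof -
    have "trapezoid e 0 (a i) t = 0 \<or> trapezoid e (b i) 1 t = 0"
      using tr(4)[of t 0 "a i"] tr(4)[of t "b i" 1] J(2)[of i] by fastforce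
    then show ?thesis using tr(2,3) by (auto simp: g_def)
  qed
  have g: "continuous_on {0..1} (g i)" "g i 0 = g i 1" for i
    using tr(4)[of 0 0 "a i"] tr(4)[of 1 0 "a i"] tr(4)[of 0 "b i" 1] tr(4)[of 1 "b i" 1] J[of i] ab[of i]
    by (auto simp: g_def intro!: continuous_intros tr(1))
  have fJ: "f i t \<le> indicator (J i) t" for i t
  proof (cases "t \<in> J i")
    case False
    then have "t \<notin> {a i<..<b i}" using J(4)[of i] by blast
    then show ?thesis using tr(4) False by (simp add: f_def)
  qed (use tr(3) in \<open>simp add: f_def\<close>)
  have Jg: "indicator (J i) t \<le> g i t" for i t
  proof (cases "t \<in> J i")
    case True
    then have "t \<in> {a i..b i}" using J(5)[of i] by blast
    then have "trapezoid e 0 (a i) t = 0" "trapezoid e (b i) 1 t = 0"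
      using tr(4)[of t 0 "a i"] tr(4)[of t "b i" 1] by auto
    with True show ?thesis by (simp add: g_def)
  qed (use g01 in auto)
  have intf: "\<bar>integral {0..1} (f i) - (b i - a i)\<bar> \<le> 4 * e" for i
    using integral_trapezoid[of e "a i" "b i"] J[of i] e by (auto simp: f_def)
  have intg: "\<bar>integral {0..1} (g i) - (b i - a i)\<bar> \<le> 4 * e" for i
  proof -
    have int: "trapezoid e c d integrable_on {0..1}" for c d
      by (intro integrable_continuous_interval tr)
    have "((\<lambda>_. 1 :: real) has_integral 1) {0..1 :: real}"
      using has_integral_const_real[of "1 :: real" 0 1] by simp
    then have "(g i has_integral 1 - integral {0..1} (trapezoid e 0 (a i)) -
        integral {0..1} (trapezoid e (b i) 1)) {0..1}"
      unfolding g_def by (intro has_integral_diff integrable_integral int)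
    then have "integral {0..1} (g i) = 1 - integral {0..1} (trapezoid e 0 (a i)) -
        integral {0..1} (trapezoid e (b i) 1)"
      by (rule integral_unique)
    then show ?thesis
      using integral_trapezoid[of e 0 "a i"] integral_trapezoid[of e "b i" 1] J[of i] ab[of i] e(1) by auto
  qed
  have prod_close: "\<bar>(\<Prod>i\<in>UNIV. integral {0..1} (\<phi> i)) - ?L\<bar> \<le> r / 2"
    if "\<And>i. continuous_on {0..1} (\<phi> i)" "\<And>i t. \<phi> i t \<in> {0..1}"
      "\<And>i. \<bar>integral {0..1} (\<phi> i) - (b i - a i)\<bar> \<le> 4 * e" for \<phi> :: "'k \<Rightarrow> real \<Rightarrow> real"
  proof -
    have "norm (integral {0..1} (\<phi> i)) \<le> 1 * (1 - 0)" for i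
      using that by (intro integral_bound) auto
    then have "norm ((\<Prod>i\<in>UNIV. integral {0..1} (\<phi> i)) - ?L) \<le>
        (\<Sum>i\<in>UNIV. norm (integral {0..1} (\<phi> i) - (b i - a i)))"
      using J ab by (intro norm_prod_diff) (auto simp: abs_le_iff intro: diff_mono[of _ 1 0, simplified])
    also have "\<dots> \<le> (\<Sum>i\<in>(UNIV::'k set). 4 * e)"
      using that by (intro sum_mono) auto
    finally show ?thesis using e by simp
  qed
  have lim_f: "(\<lambda>N. (\<Sum>n=1..N. \<Prod>i\<in>UNIV. f i (frac (x n $ i))) / real N)
      \<longlonglongrightarrow> (\<Prod>i\<in>UNIV. integral {0..1} (f i))"
    using f by (intro continuous_periodic_average_tendsto weyl) auto
  have lim_g: "(\<lambda>N. (\<Sum>n=1..N. \<Prod>i\<in>UNIV. g i (frac (x n $ i))) / real N)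
      \<longlonglongrightarrow> (\<Prod>i\<in>UNIV. integral {0..1} (g i))"
    using g g01 by (intro continuous_periodic_average_tendsto weyl) auto
  have "\<forall>\<^sub>F N in sequentially. norm (?s N - ?L) < r"
    using tendstoD[OF lim_f half_gt_zero[OF r]] tendstoD[OF lim_g half_gt_zero[OF r]]
  proof eventually_elim
    case (elim N)
    have "(\<Sum>n=1..N. \<Prod>i\<in>UNIV. f i (frac (x n $ i))) / real N \<le> ?s N"
      using f by (intro divide_right_mono sum_mono prod_mono) (auto simp: fJ)
    moreover have "?s N \<le> (\<Sum>n=1..N. \<Prod>i\<in>UNIV. g i (frac (x n $ i))) / real N"
      by (intro divide_right_mono sum_mono prod_mono) (auto simp: Jg)
    moreover have "\<bar>(\<Prod>i\<in>UNIV. integral {0..1} (f i)) - ?L\<bar> \<le> r / 2"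
      by (intro prod_close f intf)
    moreover have "\<bar>(\<Prod>i\<in>UNIV. integral {0..1} (g i)) - ?L\<bar> \<le> r / 2"
      by (intro prod_close g g01 intg)
    ultimately show ?case using elim unfolding dist_real_def real_norm_def by linarith
  qed
  then show "\<exists>no. \<forall>n\<ge>no. norm (?s n - ?L) < r"
    by (simp add: eventually_sequentially)
qed

text \<open>The set lies between an open and a closed box that differ by a null set.\<close>

lemma measure_box_between:
  fixes J :: "'k::finite \<Rightarrow> real set" and a b :: "'k \<Rightarrow> real"
  assumes J: "\<And>i. a i \<le> b i" "\<And>i. {a i<..<b i} \<subseteq> J i" "\<And>i. J i \<subseteq> {a i..b i}"
  shows "measure lebesgue {y :: real ^ 'k. \<forall>i. y $ i \<in> J i} = (\<Prod>i\<in>UNIV. b i - a i)"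
proof -
  define A B :: "real ^ 'k" where "A = (\<chi> i. a i)" and "B = (\<chi> i. b i)"
  let ?S = "{y :: real ^ 'k. \<forall>i. y $ i \<in> J i}"
  have sub: "box A B \<subseteq> ?S" "?S \<subseteq> cbox A B"
    using J(2,3) by (force simp: mem_box_cart A_def B_def)+
  have "negligible (cbox A B - box A B)"
    by (rule negligible_frontier_interval)
  then have "negligible (cbox A B - ?S)"
    by (rule negligible_subset) (use sub in auto)
  then have "measure lebesgue ?S = measure lebesgue (cbox A B)"
    using sub by (intro measure_negligible_symdiff lmeasurable_cbox)
      (auto simp: Diff_eq_empty_iff[THEN iffD2])
  also have "\<dots> = measure lborel (cbox A B)" by simp
  also have "\<dots> = (\<Prod>i\<in>UNIV. b i - a i)"
    using J(1) by (subst content_cbox_cart) (auto simp: A_def B_def interval_eq_empty_cart not_less)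
  finally show ?thesis .
qed

text \<open>A non-empty interval lies between the open and the closed interval spanned by its
  infimum and supremum, and the counting function is a sum of products of indicators, so the box
  result applies.\<close>

theorem Weyl_criterion:
  fixes x :: "nat \<Rightarrow> real ^ 'k::finite"
  assumes weyl: "\<And>h :: 'k \<Rightarrow> int. h \<noteq> (\<lambda>_. 0) \<Longrightarrow>
      (\<lambda>N. (\<Sum>n=1..N. cis (2 * pi * (\<Sum>i\<in>UNIV. of_int (h i) * x n $ i))) / of_nat N) \<longlonglongrightarrow> 0"
  shows "uniformly_distributed_mod1 x"
  unfolding uniformly_distributed_mod1_def
proof (intro allI impI)
  fix J :: "'k \<Rightarrow> real set"
  assume J: "\<forall>i. is_interval (J i) \<and> J i \<subseteq> {0..1}"
  let ?S = "{y :: real ^ 'k. \<forall>i. y $ i \<in> J i}"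
  let ?c = "\<lambda>N. real (card {n \<in> {1..N}. (\<chi> i. frac (x n $ i)) \<in> ?S}) / real N"
  show "?c \<longlonglongrightarrow> measure lebesgue ?S"
  \<comment> \<open>An empty side is treated apart, since \<open>Inf\<close> and \<open>Sup\<close>
    carry no information there; count and measure are both 0.\<close>
  proof (cases "\<exists>i. J i = {}")
    case True
    then have "?S = {}" by auto
    then show ?thesis by (simp only:) simp
  next
    case False
    define a b where "a i = Inf (J i)" and "b i = Sup (J i)" for i
    have bdd: "bdd_below (J i)" "bdd_above (J i)" for i
      using J by (meson bdd_below_Icc bdd_below_mono bdd_above_Icc bdd_above_mono)+
    have sub: "J i \<subseteq> {a i..b i}" for i
      using cInf_lower[OF _ bdd(1)] cSup_upper[OF _ bdd(2)] by (auto simp: a_def b_def)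
    have ab: "0 \<le> a i" "a i \<le> b i" "b i \<le> 1" for i
    proof -
      obtain t where "t \<in> J i" using False by auto
      with sub show "a i \<le> b i" by fastforce
      have "J i \<noteq> {}" "\<And>t. t \<in> J i \<Longrightarrow> 0 \<le> t \<and> t \<le> 1" using J False by fastforce+
      then show "0 \<le> a i" "b i \<le> 1"
        unfolding a_def b_def by (blast intro: cInf_greatest cSup_least)+
    qed
    have open_sub: "{a i<..<b i} \<subseteq> J i" for i
    proof
      fix t assume t: "t \<in> {a i<..<b i}"
      obtain u where "u \<in> J i" "u < t"
        using t False cInf_less_iff[of "J i" t] bdd by (auto simp: a_def)
      moreover obtain v where "v \<in> J i" "t < v"
        using t False less_cSup_iff[of "J i" t] bdd by (auto simp: b_def)
      ultimately show "t \<in> J i"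
        using J by (meson is_interval_1 less_imp_le)
    qed
    have "real (card {n \<in> {1..N}. (\<chi> i. frac (x n $ i)) \<in> ?S}) =
        (\<Sum>n=1..N. \<Prod>i\<in>UNIV. indicator (J i) (frac (x n $ i)))" for N
    proof -
      have "(\<Prod>i\<in>UNIV. indicator (J i) (frac (x n $ i))) =
          (if (\<chi> i. frac (x n $ i)) \<in> ?S then 1 else (0 :: real))" for n
        by (auto simp: indicator_def)
      then show ?thesis by (simp add: sum.If_cases Int_def)
    qed
    then have "?c \<longlonglongrightarrow> (\<Prod>i\<in>UNIV. b i - a i)"
      using box_average_tendsto[OF weyl ab open_sub sub] by simp
    also have "(\<Prod>i\<in>UNIV. b i - a i) = measure lebesgue ?S"
      by (rule measure_box_between[symmetric]) (use ab open_sub sub in auto)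
    finally show ?thesis .
  qed
qed

section \<open>Almost everywhere convergence of exponential averages\<close>

text \<open>For \<open>N\<close> between \<open>f j\<close> and \<open>f (Suc j)\<close>, the sum up
  to \<open>N\<close> differs from the sum up to \<open>f j\<close> by at most
  \<open>f (Suc j) - f j\<close>, which is small compared with \<open>f j\<close> by the ratio
  condition.\<close>

lemma average_tendsto_zero_of_subsequence:
  fixes z :: "nat \<Rightarrow> complex" and f :: "nat \<Rightarrow> nat"
  assumes z: "\<And>n. norm (z n) \<le> 1" and f: "mono f" "filterlim f at_top sequentially"
    and ratio: "(\<lambda>j. real (f (Suc j)) / real (f j)) \<longlonglongrightarrow> 1"
    and lim: "(\<lambda>j. (\<Sum>n=1..f j. z n) / of_nat (f j)) \<longlonglongrightarrow> 0"
  shows "(\<lambda>N. (\<Sum>n=1..N. z n) / of_nat N) \<longlonglongrightarrow> 0"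
proof (rule LIMSEQ_I)
  fix e :: real assume e: "e > 0"
  have "\<forall>\<^sub>F j in sequentially. norm ((\<Sum>n=1..f j. z n) / of_nat (f j)) < e / 2"
    using tendstoD[OF lim half_gt_zero[OF e]] by simp
  moreover have "\<forall>\<^sub>F j in sequentially. real (f (Suc j)) / real (f j) < 1 + e / 2"
    using e by (intro order_tendstoD[OF ratio]) auto
  moreover have "\<forall>\<^sub>F j in sequentially. f j \<ge> 1"
    using f(2) by (simp add: filterlim_at_top)
  ultimately have "\<forall>\<^sub>F j in sequentially. norm ((\<Sum>n=1..f j. z n) / of_nat (f j)) < e / 2 \<and>
      real (f (Suc j)) / real (f j) < 1 + e / 2 \<and> f j \<ge> 1"
    by eventually_elim auto
  then obtain J where J: "\<And>j. j \<ge> J \<Longrightarrow> norm ((\<Sum>n=1..f j. z n) / of_nat (f j)) < e / 2"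
      "\<And>j. j \<ge> J \<Longrightarrow> real (f (Suc j)) / real (f j) < 1 + e / 2" "\<And>j. j \<ge> J \<Longrightarrow> f j \<ge> 1"
    by (auto simp: eventually_sequentially)
  have "norm ((\<Sum>n=1..N. z n) / of_nat N - 0) < e" if N: "N \<ge> f J" for N
  proof -
    \<comment> \<open>The least index with \<open>f i > N\<close>; its predecessor \<open>j\<close>
      satisfies \<open>f j \<le> N < f (Suc j)\<close>, and \<open>N \<ge> f J\<close> forces
      \<open>j \<ge> J\<close>.\<close>
    define i where "i = (LEAST i. N < f i)"
    have "\<forall>\<^sub>F i in sequentially. Suc N \<le> f i"
      using f(2) unfolding filterlim_at_top by blast
    then have "\<exists>i. Suc N \<le> f i" by (rule eventually_happens'[OF sequentially_bot])
    then have "\<exists>i. N < f i" by (simp add: Suc_le_eq)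
    then have i: "N < f i" unfolding i_def by (rule LeastI_ex)
    have "i > J"
    proof (rule ccontr)
      assume "\<not> i > J"
      then have "f i \<le> f J" by (intro monoD[OF f(1)]) auto
      with N i show False by simp
    qed
    then obtain j where j: "i = Suc j" "j \<ge> J" by (cases i) auto
    have fj: "f j \<le> N" using not_less_Least[of j "\<lambda>i. N < f i"] j by (simp add: i_def)
    have pos: "f j \<ge> 1" using J(3) j by auto
    have "(\<Sum>n=1..N. z n) = (\<Sum>n=1..f j. z n) + (\<Sum>n=Suc (f j)..N. z n)"
      using sum.ub_add_nat[of 1 "f j" z "N - f j"] fj by simp
    also have "norm \<dots> \<le> norm (\<Sum>n=1..f j. z n) + real (N - f j)"
      using sum_norm_bound[of "{Suc (f j)..N}" z 1] z by (intro norm_triangle_le add_left_mono) auto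
    also have "norm (\<Sum>n=1..f j. z n) < e / 2 * f j"
      using J(1)[OF j(2)] pos by (simp add: norm_divide divide_less_eq)
    also have "real (N - f j) \<le> e / 2 * f j"
    proof -
      have "real (f (Suc j)) \<le> (1 + e / 2) * f j"
        using J(2)[OF j(2)] pos by (simp add: divide_less_eq)
      moreover have "real (N - f j) \<le> real (f (Suc j)) - real (f j)"
        using i fj unfolding j by simp
      ultimately show ?thesis by (simp add: algebra_simps)
    qed
    also have "e / 2 * f j + e / 2 * f j \<le> e * N" using fj e by simp
    finally have "norm (\<Sum>n=1..N. z n) < e * N" by simp
    then show ?thesis using pos fj by (simp add: norm_divide divide_less_eq)
  qed
  then show "\<exists>no. \<forall>N\<ge>no. norm ((\<Sum>n=1..N. z n) / of_nat N - 0) < e" by blast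
qed

text \<open>The sequence is sparse enough for summability and dense enough for interpolation: for
  \<open>\<theta> < 1\<close> the increments of \<open>j powr \<theta>\<close> tend to 0, so
  consecutive ratios tend to 1. Rounding down is harmless as the exponentials tend to infinity; in
  the logarithmic bound the factor 1/2 absorbs it.\<close>

lemma subexponential_sequence:
  fixes \<theta> :: real
  assumes "0 < \<theta>" "\<theta> < 1"
  defines "f \<equiv> \<lambda>j. nat \<lfloor>exp (real j powr \<theta>)\<rfloor>"
  shows "mono f" "filterlim f at_top sequentially"
    "(\<lambda>j. real (f (Suc j)) / real (f j)) \<longlonglongrightarrow> 1"
    "\<forall>\<^sub>F j in sequentially. real j powr \<theta> / 2 \<le> ln (real (f j))"
proof -
  define E where "E j = exp (real j powr \<theta>)" for j :: nat
  have f: "real (f j) \<le> E j" "E j - 1 \<le> real (f j)" for j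
  proof -
    have "real (f j) = of_int \<lfloor>E j\<rfloor>" by (simp add: f_def E_def)
    then show "real (f j) \<le> E j" "E j - 1 \<le> real (f j)" by linarith+
  qed
  have E: "filterlim E at_top sequentially" "filterlim (\<lambda>j. E j - 1) at_top sequentially"
  proof -
    have "filterlim (\<lambda>j. real j powr \<theta>) at_top sequentially" using assms(1) by real_asymp
    then show E1: "filterlim E at_top sequentially"
      unfolding E_def by (rule filterlim_compose[OF exp_at_top])
    show "filterlim (\<lambda>j. E j - 1) at_top sequentially"
      using filterlim_tendsto_add_at_top[OF tendsto_const E1, of "-1"] by simp
  qed
  show "mono f"
    unfolding f_def using assms by (intro monoI nat_mono floor_mono) (simp add: powr_mono2)
  have "filterlim (\<lambda>j. real (f j)) at_top sequentially"
    by (rule filterlim_at_top_mono[OF E(2)]) (simp add: f)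
  then show "filterlim f at_top sequentially"
    by (simp add: filterlim_sequentially_iff_filterlim_real)
  show "(\<lambda>j. real (f (Suc j)) / real (f j)) \<longlonglongrightarrow> 1"
  proof (rule tendsto_sandwich)
    have pos: "\<forall>\<^sub>F j in sequentially. E j - 1 > 0"
      using E(2) unfolding filterlim_at_top_dense by blast
    show "\<forall>\<^sub>F j in sequentially. (E (Suc j) - 1) / E j \<le> real (f (Suc j)) / real (f j)"
      using pos
    proof eventually_elim
      case (elim j)
      then have "0 < real (f j)" using f[of j] by linarith
      moreover have "0 \<le> E (Suc j) - 1" by (simp add: E_def)
      ultimately show ?case using f[of "Suc j"] f[of j] by (intro frac_le) auto
    qed
    show "\<forall>\<^sub>F j in sequentially. real (f (Suc j)) / real (f j) \<le> E (Suc j) / (E j - 1)"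
      using pos
    proof eventually_elim
      case (elim j)
      then show ?case using f[of "Suc j"] f[of j] by (intro frac_le) (auto simp: E_def)
    qed
    have "(\<lambda>j. real (Suc j) powr \<theta> - real j powr \<theta>) \<longlonglongrightarrow> 0"
      using assms(1,2) by real_asymp
    then have "(\<lambda>j. exp (real (Suc j) powr \<theta> - real j powr \<theta>)) \<longlonglongrightarrow> exp 0"
      by (rule tendsto_exp)
    then have ratioE: "(\<lambda>j. E (Suc j) / E j) \<longlonglongrightarrow> 1"
      by (simp add: E_def exp_diff)
    have invE: "(\<lambda>j. 1 / E j) \<longlonglongrightarrow> 0"
      using tendsto_inverse_0_at_top[OF E(1)] by (simp add: inverse_eq_divide)
    show "(\<lambda>j. (E (Suc j) - 1) / E j) \<longlonglongrightarrow> 1"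
      using tendsto_diff[OF ratioE invE] by (simp add: diff_divide_distrib)
    have "(\<lambda>j. (E (Suc j) / E j) / (1 - 1 / E j)) \<longlonglongrightarrow> 1 / (1 - 0)"
      by (intro tendsto_intros ratioE invE) simp
    moreover have "(E (Suc j) / E j) / (1 - 1 / E j) = E (Suc j) / (E j - 1)" for j
      by (simp add: E_def right_diff_distrib)
    ultimately show "(\<lambda>j. E (Suc j) / (E j - 1)) \<longlonglongrightarrow> 1" by (simp only:) simp
  qed
  \<comment> \<open>With \<open>t\<close> the square root of \<open>E j\<close>, this gives
    \<open>t \<ge> 2\<close> and hence \<open>t \<le> t^2 - 1\<close>.\<close>
  have "\<forall>\<^sub>F j in sequentially. E j \<ge> 2 ^ 2"
    using E(1) by (simp add: filterlim_at_top)
  then have "\<forall>\<^sub>F j in sequentially. exp (real j powr \<theta> / 2) \<le> E j - 1"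
  proof eventually_elim
    case (elim j)
    define t where "t = exp (real j powr \<theta> / 2)"
    have E_t: "E j = t\<^sup>2" by (simp add: E_def t_def flip: exp_double)
    then have "2 \<le> t" using elim power2_le_imp_le[of 2 t] by (simp add: t_def)
    then have "2 * t \<le> t * t" by (intro mult_right_mono) auto
    then show ?case using \<open>2 \<le> t\<close> unfolding E_t t_def[symmetric] power2_eq_square by linarith
  qed
  then show "\<forall>\<^sub>F j in sequentially. real j powr \<theta> / 2 \<le> ln (real (f j))"
  proof eventually_elim
    case (elim j)
    then have "exp (real j powr \<theta> / 2) \<le> real (f j)" using f[of j] by linarith
    then show ?case by (metis exp_gt_zero less_le_trans ln_ge_iff)
  qed
qed

section \<open>Mean square estimates and almost everywhere convergence\<close>

text \<open>The sum of the \<open>g j\<close> has finite integral, by exchanging sum and integral of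
  non-negative functions. Hence the sum is finite almost everywhere, and there its terms tend to
  0.\<close>

lemma AE_tendsto_zero_of_summable_integral:
  fixes g :: "nat \<Rightarrow> real \<Rightarrow> real"
  assumes g: "\<And>j. continuous_on UNIV (g j)" "\<And>j x. 0 \<le> g j x"
    and sm: "summable (\<lambda>j. integral {a..b} (g j))"
  shows "AE x in lebesgue. x \<in> {a..b} \<longrightarrow> (\<lambda>j. g j x) \<longlonglongrightarrow> 0"
proof -
  have int: "g j integrable_on {a..b}" for j
    using g(1) by (intro integrable_continuous_interval) (rule continuous_on_subset, auto)
  have [measurable]: "g j \<in> borel_measurable borel" for j
    using g(1) by (rule borel_measurable_continuous_onI)
  have "(\<integral>\<^sup>+x. (\<Sum>j. ennreal (g j x) * indicator {a..b} x) \<partial>lborel) =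
      (\<Sum>j. \<integral>\<^sup>+x. ennreal (g j x) * indicator {a..b} x \<partial>lborel)"
    by (rule nn_integral_suminf) measurable
  also have "\<dots> = (\<Sum>j. ennreal (integral {a..b} (g j)))"
    using g(2) int by (intro suminf_cong nn_integral_has_integral_lebesgue') (auto simp: integrable_integral)
  also have "\<dots> \<noteq> \<infinity>"
    unfolding infinity_ennreal_def
    by (intro ennreal_suminf_neq_top[OF sm] Henstock_Kurzweil_Integration.integral_nonneg int g)
  finally have fin: "(\<integral>\<^sup>+x. (\<Sum>j. ennreal (g j x) * indicator {a..b} x) \<partial>lborel) \<noteq> \<infinity>" .
  have "AE x in lborel. (\<Sum>j. ennreal (g j x) * indicator {a..b} x) \<noteq> \<infinity>"
    by (rule nn_integral_noteq_infinite[OF _ fin]) measurable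
  then have "AE x in lborel. x \<in> {a..b} \<longrightarrow> (\<lambda>j. g j x) \<longlonglongrightarrow> 0"
  proof (rule AE_mp, intro AE_I2 impI)
    fix x assume "(\<Sum>j. ennreal (g j x) * indicator {a..b} x) \<noteq> \<infinity>" "x \<in> {a..b}"
    then have "summable (\<lambda>j. g j x)"
      using g(2) by (intro summable_suminf_not_top) auto
    then show "(\<lambda>j. g j x) \<longlonglongrightarrow> 0" by (rule summable_LIMSEQ_zero)
  qed
  then show ?thesis by (rule AE_completion)
qed

text \<open>Expanding the square gives a double sum of integrals with phases
  \<open>Q n - Q m\<close>, whose coefficient at \<open>d\<close> governs van der Corput's bound;
  the trivial bound covers equal coefficients and the cap at 1. The diagonal contributes
  \<open>N\<close>, and symmetry of \<open>w\<close> doubles the sum over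
  \<open>m < n\<close>.\<close>

lemma integral_norm_exp_sum_le:
  fixes Q :: "nat \<Rightarrow> real poly" and N :: nat
  assumes ab: "a \<le> b" and d: "d > 0" and deg: "\<And>n. degree (Q n) \<le> d"
  defines "w \<equiv> \<lambda>m n. if coeff (Q n) d = coeff (Q m) d then 1
      else min (\<bar>coeff (Q n) d - coeff (Q m) d\<bar> powr - (1 / real d)) 1"
  shows "integral {a..b} (\<lambda>x. (norm (\<Sum>n=1..N. cis (poly (Q n) x)))\<^sup>2) \<le>
    (b - a + 4 ^ d) * (real N + 2 * (\<Sum>(m, n) \<in> {(m, n). 1 \<le> m \<and> m < n \<and> n \<le> N}. w m n))"
proof -
  \<comment> \<open>\<open>K\<close> dominates both the length of the interval and van der Corput's
    constant, so one constant serves in all cases.\<close>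
  define K where "K = b - a + 4 ^ d"
  \<comment> \<open>The squared norm is real, so only real parts are kept; this makes a termwise
    inequality between real numbers possible.\<close>
  define I where "I m n = integral {a..b} (\<lambda>x. Re (cis (poly (Q n - Q m) x)))" for m n
  have K: "K \<ge> b - a" "K \<ge> 4 ^ d" using ab by (auto simp: K_def)
  have Iw: "I m n \<le> K * w m n" for m n
  proof -
    let ?J = "integral {a..b} (\<lambda>x. cis (poly (Q n - Q m) x))"
    have "I m n = Re ?J"
      unfolding I_def
      using integral_linear[OF integrable_continuous_interval bounded_linear_Re, of a b "\<lambda>x. cis (poly (Q n - Q m) x)"]
      by (simp add: o_def continuous_intros)
    also have "\<dots> \<le> norm ?J" by (rule complex_Re_le_cmod)
    also have "\<dots> \<le> K * w m n"
    proof (cases "coeff (Q n) d = coeff (Q m) d")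
      case True
      then show ?thesis using norm_integral_cis_le[OF ab, of "Q n - Q m"] K by (simp add: w_def)
    next
      case False
      let ?p = "\<bar>coeff (Q n) d - coeff (Q m) d\<bar> powr - (1 / real d)"
      have "norm ?J \<le> 4 ^ d * \<bar>coeff (Q n - Q m) d\<bar> powr - (1 / real d)"
        using False deg by (intro norm_integral_cis_poly_leading_coeff ab d degree_diff_le) auto
      also have "\<dots> \<le> K * ?p" unfolding coeff_diff using K by (intro mult_right_mono) auto
      finally have "norm ?J \<le> K * ?p" .
      moreover have "norm ?J \<le> K" using norm_integral_cis_le[OF ab, of "Q n - Q m"] K by linarith
      ultimately show ?thesis using False by (simp add: w_def min_def)
    qed
    finally show ?thesis .
  qed
  have "(norm (\<Sum>n=1..N. cis (poly (Q n) x)))\<^sup>2 =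
      (\<Sum>m=1..N. \<Sum>n=1..N. Re (cis (poly (Q n - Q m) x)))" for x
  proof -
    have "complex_of_real ((norm (\<Sum>n=1..N. cis (poly (Q n) x)))\<^sup>2) =
        (\<Sum>n=1..N. cis (poly (Q n) x)) * cnj (\<Sum>n=1..N. cis (poly (Q n) x))"
      by (rule complex_norm_square)
    also have "\<dots> = (\<Sum>n=1..N. \<Sum>m=1..N. cis (poly (Q n - Q m) x))"
      by (simp add: cis_cnj cis_mult sum_product)
    also have "\<dots> = (\<Sum>m=1..N. \<Sum>n=1..N. cis (poly (Q n - Q m) x))"
      by (rule sum.swap)
    finally have *: "complex_of_real ((norm (\<Sum>n=1..N. cis (poly (Q n) x)))\<^sup>2) =
        (\<Sum>m=1..N. \<Sum>n=1..N. cis (poly (Q n - Q m) x))" .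
    from arg_cong[OF *, of Re] show ?thesis by (simp only: Re_complex_of_real Re_sum)
  qed
  then have "integral {a..b} (\<lambda>x. (norm (\<Sum>n=1..N. cis (poly (Q n) x)))\<^sup>2) =
      integral {a..b} (\<lambda>x. \<Sum>m=1..N. \<Sum>n=1..N. Re (cis (poly (Q n - Q m) x)))"
    by simp
  also have "\<dots> = (\<Sum>m=1..N. \<Sum>n=1..N. I m n)"
    unfolding I_def
    by (subst Henstock_Kurzweil_Integration.integral_sum; (intro sum.cong refl Henstock_Kurzweil_Integration.integral_sum)?;
        intro finite_atLeastAtMost integrable_continuous_interval continuous_intros)
  also have "\<dots> \<le> (\<Sum>m=1..N. \<Sum>n=1..N. K * w m n)"
    by (intro sum_mono Iw)
  also have "\<dots> = K * (\<Sum>p\<in>{1..N} \<times> {1..N}. case_prod w p)"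
    by (simp add: sum_distrib_left sum.cartesian_product case_prod_unfold)
  also have "(\<Sum>p\<in>{1..N} \<times> {1..N}. case_prod w p) =
      real N + 2 * (\<Sum>(m, n) \<in> {(m, n). 1 \<le> m \<and> m < n \<and> n \<le> N}. w m n)"
  proof -
    let ?U = "{(m, n). 1 \<le> m \<and> m < n \<and> n \<le> N}"
    let ?L = "{(m, n). 1 \<le> n \<and> n < m \<and> m \<le> N}"
    let ?D = "(\<lambda>n. (n, n)) ` {1..N}"
    have fin: "finite ?U" "finite ?L"
      by (rule finite_subset[of _ "{1..N} \<times> {1..N}"]; auto)+
    have "{1..N} \<times> {1..N} = ?D \<union> (?U \<union> ?L)" by force
    then have "(\<Sum>p\<in>{1..N} \<times> {1..N}. case_prod w p) = sum (case_prod w) ?D + sum (case_prod w) (?U \<union> ?L)"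
      using fin by (simp only:) (rule sum.union_disjoint, auto)
    also have "sum (case_prod w) (?U \<union> ?L) = sum (case_prod w) ?U + sum (case_prod w) ?L"
      using fin by (intro sum.union_disjoint) auto
    also have "sum (case_prod w) ?D = real N"
      by (subst sum.reindex) (auto simp: inj_on_def w_def)
    also have "sum (case_prod w) ?L = sum (case_prod w) ?U"
      by (rule sum.reindex_bij_witness[of _ prod.swap prod.swap]) (auto simp: w_def abs_minus_commute)
    finally show ?thesis by simp
  qed
  finally show ?thesis unfolding K_def .
qed

lemma AE_exp_average_tendsto_zero:
  fixes Q :: "nat \<Rightarrow> real poly"
  assumes ab: "a \<le> b" and d: "d > 0" and deg: "\<And>n. degree (Q n) \<le> d"
    and scat: "delta_scattered (1 / real d) (\<lambda>n. coeff (Q n) d)"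
  shows "AE x in lebesgue. x \<in> {a..b} \<longrightarrow>
    (\<lambda>N. (\<Sum>n=1..N. cis (poly (Q n) x)) / of_nat N) \<longlonglongrightarrow> 0"
proof -
  define w where "w m n = (if coeff (Q n) d = coeff (Q m) d then 1
      else min (\<bar>coeff (Q n) d - coeff (Q m) d\<bar> powr - (1 / real d)) 1)" for m n
  define W where "W N = (\<Sum>(m, n) \<in> {(m, n). 1 \<le> m \<and> m < n \<and> n \<le> N}. w m n)" for N
  obtain \<epsilon> where \<epsilon>: "\<epsilon> > 0"
    "\<forall>\<^sub>F N in sequentially. 1 / (real N)\<^sup>2 * W N \<le> 1 / ln (real N) powr (1 + \<epsilon>)"
    using scat unfolding delta_scattered_def W_def w_def by auto
  define K where "K = b - a + 4 ^ d"
  have K: "K > 0" using ab by (simp add: K_def add_nonneg_pos)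
  define g where "g N x = (norm ((\<Sum>n=1..N. cis (poly (Q n) x)) / of_nat N))\<^sup>2" for N x
  have cont_g: "continuous_on S (g N)" for S N
    unfolding g_def by (cases "N = 0") (auto intro!: continuous_intros)
  have g_nonneg: "0 \<le> g N x" for N x
    by (simp add: g_def)
  have int_g: "integral {a..b} (g N) \<le> K * (1 / real N + 2 * (1 / (real N)\<^sup>2 * W N))" for N
  proof -
    have "integral {a..b} (g N) = integral {a..b} (\<lambda>x. 1 / (real N)\<^sup>2 * (norm (\<Sum>n=1..N. cis (poly (Q n) x)))\<^sup>2)"
      unfolding g_def by (simp add: norm_divide power_divide)
    also have "\<dots> = 1 / (real N)\<^sup>2 * integral {a..b} (\<lambda>x. (norm (\<Sum>n=1..N. cis (poly (Q n) x)))\<^sup>2)"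
      by (rule integral_mult_right)
    also have "\<dots> \<le> 1 / (real N)\<^sup>2 * (K * (real N + 2 * W N))"
      unfolding K_def W_def w_def using integral_norm_exp_sum_le[OF ab d deg]
      by (intro mult_left_mono) auto
    also have "\<dots> = K * (1 / real N + 2 * (1 / (real N)\<^sup>2 * W N))"
      by (cases "N = 0") (simp_all add: field_simps power2_eq_square)
    finally show ?thesis .
  qed
  \<comment> \<open>The diagonal term is eventually absorbed by the scattering bound; together with
    twice the off-diagonal term it produces the factor 3.\<close>
  have "\<forall>\<^sub>F N in sequentially. 1 / real N \<le> 1 / ln (real N) powr (1 + \<epsilon>)"
    using \<epsilon>(1) by real_asymp
  with \<epsilon>(2) have bound: "\<forall>\<^sub>F N in sequentially. integral {a..b} (g N) \<le> 3 * K / ln (real N) powr (1 + \<epsilon>)"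
  proof eventually_elim
    case (elim N)
    have "integral {a..b} (g N) \<le> K * (1 / real N + 2 * (1 / (real N)\<^sup>2 * W N))" by (rule int_g)
    also have "\<dots> \<le> K * (3 * (1 / ln (real N) powr (1 + \<epsilon>)))"
      using elim K by (intro mult_left_mono) linarith+
    finally show ?case by (simp add: mult_ac)
  qed
  \<comment> \<open>A choice strictly between \<open>1 / (1 + \<epsilon>)\<close> and 1: above the
    former the bounds are summable along \<open>f\<close>, below the latter the ratios of
    \<open>f\<close> tend to 1.\<close>
  define \<theta> where "\<theta> = 2 / (2 + \<epsilon>)"
  have \<theta>: "0 < \<theta>" "\<theta> < 1" using \<epsilon>(1) by (auto simp: \<theta>_def)
  have \<theta>\<epsilon>: "\<theta> * (1 + \<epsilon>) > 1" using \<epsilon>(1) by (simp add: \<theta>_def field_simps)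
  define f where "f j = nat \<lfloor>exp (real j powr \<theta>)\<rfloor>" for j
  have f: "mono f" "filterlim f at_top sequentially" "(\<lambda>j. real (f (Suc j)) / real (f j)) \<longlonglongrightarrow> 1"
    "\<forall>\<^sub>F j in sequentially. real j powr \<theta> / 2 \<le> ln (real (f j))"
    using subexponential_sequence[OF \<theta>] unfolding f_def by auto
  have "\<forall>\<^sub>F j in sequentially. integral {a..b} (g (f j)) \<le> 3 * K / ln (real (f j)) powr (1 + \<epsilon>)"
    using filterlim_iff[THEN iffD1, OF f(2)] bound by blast
  \<comment> \<open>The factor \<open>2 powr (1 + \<epsilon>)\<close> comes from the 1/2 in the
    lower bound for \<open>ln (real (f j))\<close>.\<close>
  then have "\<forall>\<^sub>F j in sequentially. norm (integral {a..b} (g (f j))) \<le>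
      3 * K * 2 powr (1 + \<epsilon>) * real j powr - (\<theta> * (1 + \<epsilon>))"
    using f(4) eventually_gt_at_top[of 0]
  proof eventually_elim
    case (elim j)
    have "(real j powr \<theta> / 2) powr (1 + \<epsilon>) \<le> ln (real (f j)) powr (1 + \<epsilon>)"
      using elim \<epsilon>(1) by (intro powr_mono2) auto
    moreover have "(real j powr \<theta> / 2) powr (1 + \<epsilon>) = real j powr (\<theta> * (1 + \<epsilon>)) / 2 powr (1 + \<epsilon>)"
      by (simp add: powr_divide powr_powr)
    ultimately have "3 * K / ln (real (f j)) powr (1 + \<epsilon>) \<le>
        3 * K / (real j powr (\<theta> * (1 + \<epsilon>)) / 2 powr (1 + \<epsilon>))"
      using K elim by (intro frac_le) auto
    moreover have "integral {a..b} (g (f j)) \<ge> 0"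
      by (intro Henstock_Kurzweil_Integration.integral_nonneg integrable_continuous_interval cont_g g_nonneg)
    ultimately show ?case using elim by (simp add: powr_minus_divide)
  qed
  moreover have "summable (\<lambda>j. 3 * K * 2 powr (1 + \<epsilon>) * real j powr - (\<theta> * (1 + \<epsilon>)))"
    using \<theta>\<epsilon> by (intro summable_mult) (subst summable_real_powr_iff, simp)
  ultimately have "summable (\<lambda>j. integral {a..b} (g (f j)))"
    by (rule summable_comparison_test_ev)
  then have "AE x in lebesgue. x \<in> {a..b} \<longrightarrow> (\<lambda>j. g (f j) x) \<longlonglongrightarrow> 0"
    by (intro AE_tendsto_zero_of_summable_integral cont_g g_nonneg)
  then show ?thesis
  proof (rule AE_mp, intro AE_I2 impI)
    fix x assume x: "x \<in> {a..b} \<longrightarrow> (\<lambda>j. g (f j) x) \<longlonglongrightarrow> 0" "x \<in> {a..b}"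
    then have "(\<lambda>j. sqrt (g (f j) x)) \<longlonglongrightarrow> sqrt 0" by (intro tendsto_real_sqrt) auto
    then have "(\<lambda>j. (\<Sum>n=1..f j. cis (poly (Q n) x)) / of_nat (f j)) \<longlonglongrightarrow> 0"
      by (simp add: g_def tendsto_norm_zero_iff)
    then show "(\<lambda>N. (\<Sum>n=1..N. cis (poly (Q n) x)) / of_nat N) \<longlonglongrightarrow> 0"
      by (intro average_tendsto_zero_of_subsequence[OF _ f(1-3)]) auto
  qed
qed

section \<open>Application to the given polynomials and sequences\<close>

theorem theorem1p6:
  fixes p :: "'k::finite \<Rightarrow> real poly"
    and a :: "'k \<Rightarrow> nat \<Rightarrow> real"
  assumes "\<And>i. degree (p i) > 0"
    and "jointly_scattered a"
  shows "AE x in lebesgue. uniformly_distributed_mod1 (\<lambda>n. \<chi> i. a i n * poly (p i) x)"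
proof -
  \<comment> \<open>The integral estimates concern bounded intervals, so the line is exhausted by
    the intervals \<open>{- real R..real R}\<close>.\<close>
  have "AE x in lebesgue. x \<in> {- real R..real R} \<longrightarrow>
      (\<lambda>N. (\<Sum>n=1..N. cis (2 * pi * (\<Sum>i\<in>UNIV. of_int (h i) * (a i n * poly (p i) x)))) / of_nat N) \<longlonglongrightarrow> 0"
    if h: "h \<noteq> (\<lambda>_. 0)" for h :: "'k \<Rightarrow> int" and R :: nat
  proof -
    \<comment> \<open>For this choice of \<open>d\<close>, the coefficient of \<open>x\<^sup>d\<close> is the highest one in every phase
      polynomial, and it is a fixed non-zero linear combination of the \<open>a i n\<close>.\<close>
    define d where "d = Max ((\<lambda>i. degree (p i)) ` {i. h i \<noteq> 0})"
    have ne: "(\<lambda>i. degree (p i)) ` {i. h i \<noteq> 0} \<noteq> {}" using h by (auto simp: fun_eq_iff)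
    have deg: "degree (p i) \<le> d" if "h i \<noteq> 0" for i
      unfolding d_def using that by (intro Max_ge) auto
    obtain j where j: "h j \<noteq> 0" "degree (p j) = d"
      using Max_in[OF _ ne] by (auto simp: d_def)
    then have d: "d > 0" using assms(1)[of j] by simp
    define Q where "Q n = (\<Sum>i\<in>UNIV. smult (2 * pi * of_int (h i) * a i n) (p i))" for n
    \<comment> \<open>Indices with \<open>degree (p i) < d\<close> contribute 0, while
      \<open>v $ j\<close> contains the leading coefficient of \<open>p j\<close> and so is
      non-zero.\<close>
    define v where "v = (\<chi> i. 2 * pi * of_int (h i) * coeff (p i) d)"
    have "v $ j \<noteq> 0" using j d by (auto simp: v_def)
    then have "v \<noteq> 0" by auto
    then have "delta_scattered (1 / real d) (\<lambda>n. \<Sum>i\<in>UNIV. v $ i * a i n)"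
      using assms(2) d unfolding jointly_scattered_def scattered_def by auto
    also have "(\<lambda>n. \<Sum>i\<in>UNIV. v $ i * a i n) = (\<lambda>n. coeff (Q n) d)"
      by (simp add: Q_def v_def coeff_sum mult_ac)
    finally have "AE x in lebesgue. x \<in> {- real R..real R} \<longrightarrow>
        (\<lambda>N. (\<Sum>n=1..N. cis (poly (Q n) x)) / of_nat N) \<longlonglongrightarrow> 0"
    proof (intro AE_exp_average_tendsto_zero[OF _ d])
      show "degree (Q n) \<le> d" for n
        unfolding Q_def
      proof (intro degree_sum_le)
        show "degree (smult (2 * pi * of_int (h i) * a i n) (p i)) \<le> d" for i
          using deg[of i] by (cases "h i = 0") (auto intro: order_trans[OF degree_smult_le])
      qed simp
    qed auto
    moreover have "poly (Q n) x = 2 * pi * (\<Sum>i\<in>UNIV. of_int (h i) * (a i n * poly (p i) x))" for n x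
      by (simp add: Q_def poly_sum sum_distrib_left mult_ac)
    ultimately show ?thesis by simp
  qed
  \<comment> \<open>There are only countably many pairs of \<open>h\<close> and \<open>R\<close>,
    because \<open>'k\<close> is finite, so the exceptional null sets can be united.\<close>
  then have "AE x in lebesgue. \<forall>h::'k \<Rightarrow> int. \<forall>R::nat. h \<noteq> (\<lambda>_. 0) \<longrightarrow> x \<in> {- real R..real R} \<longrightarrow>
      (\<lambda>N. (\<Sum>n=1..N. cis (2 * pi * (\<Sum>i\<in>UNIV. of_int (h i) * (a i n * poly (p i) x)))) / of_nat N) \<longlonglongrightarrow> 0"
    by (subst AE_all_countable, subst AE_all_countable) auto
  then show ?thesis
  proof (rule AE_mp, intro AE_I2 impI)
    fix x :: real
    assume *: "\<forall>h::'k \<Rightarrow> int. \<forall>R::nat. h \<noteq> (\<lambda>_. 0) \<longrightarrow> x \<in> {- real R..real R} \<longrightarrow>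
      (\<lambda>N. (\<Sum>n=1..N. cis (2 * pi * (\<Sum>i\<in>UNIV. of_int (h i) * (a i n * poly (p i) x)))) / of_nat N) \<longlonglongrightarrow> 0"
    obtain R :: nat where "\<bar>x\<bar> \<le> real R" using real_arch_simple by blast
    then have "x \<in> {- real R..real R}" by auto
    then have "(\<lambda>N. (\<Sum>n=1..N. cis (2 * pi * (\<Sum>i\<in>UNIV. of_int (h i) * (a i n * poly (p i) x)))) / of_nat N)
        \<longlonglongrightarrow> 0" if "h \<noteq> (\<lambda>_. 0)" for h :: "'k \<Rightarrow> int"
      using *[rule_format, OF that] by blast
    then show "uniformly_distributed_mod1 (\<lambda>n. \<chi> i. a i n * poly (p i) x)"
      by (intro Weyl_criterion) simp
  qed
qed

end
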